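(* Let $\mathcal{G}$ be a group prevariety and let $\mathcal{A}=(Q,\delta)$ be an NFA (without $\varepsilon$-transitions). Then $\mathcal{I}_{BPol(\mathcal{G})}[\mathcal{G},\mathcal{A}]$ is the greatest (for inclusion) $(BPol,* )$-sound subset of $Q^4$ for $\mathcal{G}$ and $\mathcal{A}$.
   Context: Fix a finite alphabet $A$; languages are subsets of $A^*$ and a class is a set of languages. A lattice is a class containing $\emptyset$ and $A^*$ and closed under union and intersection; a Boolean algebra is a lattice closed under complement. A prevariety is a Boolean algebra of regular languages closed under quotients ($L\mapsto v^{-1}L=\{w\mid vw\in L\}$ and $L\mapsto Lv^{-1}=\{w\mid wv\in L\}$ for $v\in A^*$). A group language is a language of the form $\eta^{-1}(F)$ for a morphism $\eta:A^*\to G$ into a finite group and $F\subseteq G$. A group prevariety is a prevariety containing only group languages. $Pol(\mathcal{C})$ is the class of all finite unions of languages $L_0a_1L_1\cdots a_nL_n$ with $n\ge 0$, $a_i\in A$, $L_i\in\mathcal{C}$. $BPol(\mathcal{C})$ is the least Boolean algebra containing $Pol(\mathcal{C})$. An NFA is a pair $\mathcal{A}=(Q,\delta)$ with $Q$ a finite set of states and $\delta\subseteq Q\times A\times Q$; $L_{\mathcal{A}}(q,r)$ is the set of words labeling a run from $q$ to $r$ (the empty run gives $\varepsilon\in L_{\mathcal{A}}(q,q)$). For NFAs with $\varepsilon$-transitions (transitions labeled in $A\cup\{\varepsilon\}$) the same notation is used with the standard semantics. $L_0$ is $\mathcal{C}$-separable from $L_1$ if there is $K\in\mathcal{C}$ with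 $L_0\subseteq K$ and $K\cap L_1=\emptyset$. $L_0$ is $\mathcal{C}$-separable from $L_1$ under $\mathcal{D}$-control if there is $H\in\mathcal{D}$ with $\varepsilon\in H$ such that $L_0\cap H$ is $\mathcal{C}$-separable from $L_1\cap H$. Define $$\mathcal{I}_{\mathcal{C}}[\mathcal{D},\mathcal{A}]=\{(q,r,s,t)\in Q^4\mid L_{\mathcal{A}}(q,r)\text{ is not }\mathcal{C}\text{-separable from }L_{\mathcal{A}}(s,t)\text{ under }\mathcal{D}\text{-control}\}.$$ For $S\subseteq Q^4$, let $\mathcal{B}_S=(Q^3,\gamma_S)$ be the NFA with $\varepsilon$-transitions whose transitions are: (i) $((s_1,s_2,s_3),a,(t_1,t_2,t_3))$ for $a\in A$ and $(s_i,a,t_i)\in\delta$ for $i=1,2,3$; (ii) $((q_1,q_2,q_3),\varepsilon,(q_1,r_2,r_3))$ for every $q_1\in Q$ and every $(q_2,r_2,q_3,r_3)\in S$. Define $\tau_{\mathcal{A},\mathcal{G}}(S)\subseteq Q^4$ as the set of all $(q,r,s,t)\in Q^4$ such that $\{\varepsilon\}$ is not $\mathcal{G}$-separable from $L_{\mathcal{B}_S}((s,q,s),(t,r,t))$ and $\{\varepsilon\}$ is not $\mathcal{G}$-separable from $L_{\mathcal{B}_S}((q,s,q),(r,t,r))$. A set $S\subseteq Q^4$ is $(BPol,* )$-sound for $\mathcal{G}$ and $\mathcal{A}$ if $\tau_{\mathcal{A},\mathcal{G}}(S)=S$. (The map $\tau_{\mathcal{A},\mathcal{G}}$ is monotone for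 inclusion, so a greatest such set exists.) *)

theory Defs
  imports "HOL-Algebra.Weak_Morphisms"
begin

section \<open>Classes of languages\<close>

type_synonym 'a lang = "'a list set"

definition lang_lattice :: "'a lang set \<Rightarrow> bool" where
  "lang_lattice C \<longleftrightarrow> {} \<in> C \<and> UNIV \<in> C \<and>
     (\<forall>K\<in>C. \<forall>L\<in>C. K \<union> L \<in> C) \<and> (\<forall>K\<in>C. \<forall>L\<in>C. K \<inter> L \<in> C)"

definition lang_boolean_algebra :: "'a lang set \<Rightarrow> bool" where
  "lang_boolean_algebra C \<longleftrightarrow> lang_lattice C \<and> (\<forall>L\<in>C. - L \<in> C)"

definition left_quotient :: "'a list \<Rightarrow> 'a lang \<Rightarrow> 'a lang" where
  "left_quotient v L = {w. v @ w \<in> L}"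

definition right_quotient :: "'a lang \<Rightarrow> 'a list \<Rightarrow> 'a lang" where
  "right_quotient L v = {w. w @ v \<in> L}"

definition quotient_closed :: "'a lang set \<Rightarrow> bool" where
  "quotient_closed C \<longleftrightarrow> (\<forall>L\<in>C. \<forall>v. left_quotient v L \<in> C \<and> right_quotient L v \<in> C)"


section \<open>Automata\<close>

text \<open>
  The label type \<open>'l\<close> is the alphabet \<open>'a\<close> for an NFA without \<open>\<epsilon>\<close>-transitions, and \<open>'a option\<close>,
  with \<open>None\<close> for \<open>\<epsilon>\<close>, for an NFA with \<open>\<epsilon>\<close>-transitions.
\<close>

record ('q, 'l) nfa =
  states :: "'q set"
  trans :: "('q \<times> 'l \<times> 'q) set"

definition is_nfa :: "('q, 'l) nfa \<Rightarrow> bool" where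
  "is_nfa \<A> \<longleftrightarrow> finite (states \<A>) \<and> trans \<A> \<subseteq> states \<A> \<times> UNIV \<times> states \<A>"

inductive run :: "('q, 'a) nfa \<Rightarrow> 'q \<Rightarrow> 'a list \<Rightarrow> 'q \<Rightarrow> bool" for \<A> where
  run_empty: "run \<A> q [] q"
| run_letter: "(p, a, q) \<in> trans \<A> \<Longrightarrow> run \<A> q w r \<Longrightarrow> run \<A> p (a # w) r"

inductive eps_run :: "('q, 'a option) nfa \<Rightarrow> 'q \<Rightarrow> 'a list \<Rightarrow> 'q \<Rightarrow> bool" for \<B> where
  eps_run_empty: "eps_run \<B> q [] q"
| eps_run_letter: "(p, Some a, q) \<in> trans \<B> \<Longrightarrow> eps_run \<B> q w r \<Longrightarrow> eps_run \<B> p (a # w) r"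
| eps_run_eps: "(p, None, q) \<in> trans \<B> \<Longrightarrow> eps_run \<B> q w r \<Longrightarrow> eps_run \<B> p w r"

definition nfa_lang :: "('q, 'a) nfa \<Rightarrow> 'q \<Rightarrow> 'q \<Rightarrow> 'a lang" where
  "nfa_lang \<A> q r = {w. run \<A> q w r}"

definition eps_lang :: "('q, 'a option) nfa \<Rightarrow> 'q \<Rightarrow> 'q \<Rightarrow> 'a lang" where
  "eps_lang \<B> q r = {w. eps_run \<B> q w r}"


section \<open>Regular languages, group languages, prevarieties\<close>

text \<open>
  A definition cannot quantify over types, so the automata and groups below are taken over
  \<open>nat\<close>. As they are finite this is no restriction: see \<open>regularI\<close> and \<open>group_languageI\<close>.
\<close>

definition regular :: "'a lang \<Rightarrow> bool" where
  "regular L \<longleftrightarrow> (\<exists>(\<A> :: (nat, 'a) nfa) I F. is_nfa \<A> \<and> I \<subseteq> states \<A> \<and> F \<subseteq> states \<A> \<and>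
     L = (\<Union>q\<in>I. \<Union>r\<in>F. nfa_lang \<A> q r))"

definition word_monoid :: "'a list monoid" where
  "word_monoid = \<lparr>carrier = UNIV, mult = (@), one = []\<rparr>"

definition group_language :: "'a lang \<Rightarrow> bool" where
  "group_language L \<longleftrightarrow> (\<exists>(G :: nat monoid) \<eta> F. group G \<and> finite (carrier G) \<and>
     \<eta> \<in> hom word_monoid G \<and> \<eta> [] = \<one>\<^bsub>G\<^esub> \<and> F \<subseteq> carrier G \<and> L = \<eta> -` F)"

definition prevariety :: "'a lang set \<Rightarrow> bool" where
  "prevariety C \<longleftrightarrow> lang_boolean_algebra C \<and> (\<forall>L\<in>C. regular L) \<and> quotient_closed C"

definition group_prevariety :: "'a lang set \<Rightarrow> bool" where
  "group_prevariety C \<longleftrightarrow> prevariety C \<and> (\<forall>L\<in>C. group_language L)"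

lemma regularI:
  fixes \<A> :: "('q, 'a) nfa"
  assumes nfa: "is_nfa \<A>" and IF: "I \<subseteq> states \<A>" "F \<subseteq> states \<A>"
  shows "regular (\<Union>q\<in>I. \<Union>r\<in>F. nfa_lang \<A> q r)"
proof -
  have fin: "finite (states \<A>)" and sub: "trans \<A> \<subseteq> states \<A> \<times> UNIV \<times> states \<A>"
    using nfa by (auto simp: is_nfa_def)
  obtain f :: "'q \<Rightarrow> nat" where inj: "inj_on f (states \<A>)"
    using finite_imp_inj_to_nat_seg[OF fin] by blast
  define \<B> where "\<B> = \<lparr>states = f ` states \<A>, trans = (\<lambda>(p, a, q). (f p, a, f q)) ` trans \<A>\<rparr>"
  have "is_nfa \<B>"
    using fin sub by (force simp: is_nfa_def \<B>_def)
  have fwd: "run \<B> (f q) w (f r)" if "run \<A> q w r" for q w r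
    using that by induction (force intro: run.intros simp: \<B>_def)+
  have bwd: "run \<A> q w r"
    if "run \<B> x w y" "x = f q" "y = f r" "q \<in> states \<A>" "r \<in> states \<A>" for x w y q r
    using that
  proof (induction arbitrary: q)
    case (run_empty x)
    then show ?case using inj by (auto dest: inj_onD intro: run.intros)
  next
    case (run_letter x a y w z)
    then obtain p p' where tr: "(p, a, p') \<in> trans \<A>" "x = f p" "y = f p'"
      by (auto simp: \<B>_def)
    then have "p \<in> states \<A>" "p' \<in> states \<A>" using sub by auto
    then show ?case
      using run_letter tr inj by (metis inj_onD run.run_letter)
  qed
  have "nfa_lang \<B> (f q) (f r) = nfa_lang \<A> q r" if "q \<in> I" "r \<in> F" for q r
    using that IF fwd bwd[OF _ refl refl] unfolding nfa_lang_def by blast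
  then have "(\<Union>q\<in>I. \<Union>r\<in>F. nfa_lang \<A> q r) = (\<Union>q\<in>f ` I. \<Union>r\<in>f ` F. nfa_lang \<B> q r)"
    by simp
  moreover have "f ` I \<subseteq> states \<B>" "f ` F \<subseteq> states \<B>"
    using IF by (auto simp: \<B>_def)
  ultimately show ?thesis
    using \<open>is_nfa \<B>\<close> unfolding regular_def by blast
qed

lemma group_languageI:
  fixes G :: "'g monoid"
  assumes G: "group G" "finite (carrier G)"
    and \<eta>: "\<eta> \<in> hom word_monoid G" and F: "F \<subseteq> carrier G"
  shows "group_language (\<eta> -` F)"
proof -
  interpret group G by fact
  obtain f :: "'g \<Rightarrow> nat" where inj: "inj_on f (carrier G)"
    using finite_imp_inj_to_nat_seg[OF G(2)] by blast
  let ?H = "image_group f G"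
  have H: "group ?H"
    using inj by (rule inj_imp_image_group_is_group)
  have fin: "finite (carrier ?H)"
    using G(2) by (simp add: image_group_def)
  have f: "f \<in> hom G ?H"
    using inj_imp_image_group_iso[OF inj] by (simp add: iso_def)
  have \<eta>': "f \<circ> \<eta> \<in> hom word_monoid ?H"
    using Group.hom_compose[OF \<eta> f] .
  have wf: "\<eta> w \<in> carrier G" for w
    using \<eta> by (auto simp: hom_def word_monoid_def)
  have "\<eta> [] \<otimes>\<^bsub>G\<^esub> \<eta> [] = \<eta> []"
    using \<eta> unfolding hom_def word_monoid_def by simp (metis append_Nil)
  then have "\<eta> [] = \<one>\<^bsub>G\<^esub>"
    using wf l_cancel_one by blast
  then have one: "(f \<circ> \<eta>) [] = \<one>\<^bsub>?H\<^esub>"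
    by (simp add: image_group_def)
  have "\<eta> -` F = (f \<circ> \<eta>) -` (f ` F)"
    using inj_on_image_mem_iff[OF inj wf F] by (simp only: set_eq_iff vimage_eq comp_apply simp_thms)
  moreover have "f ` F \<subseteq> carrier ?H"
    using F by (auto simp: image_group_def)
  ultimately show ?thesis
    using H fin \<eta>' one unfolding group_language_def by blast
qed


section \<open>Polynomial closure\<close>

definition conc :: "'a lang \<Rightarrow> 'a lang \<Rightarrow> 'a lang" where
  "conc K L = {u @ v | u v. u \<in> K \<and> v \<in> L}"

text \<open>\<open>marked_product L\<^sub>0 [(a\<^sub>1, L\<^sub>1), \<dots>, (a\<^sub>n, L\<^sub>n)]\<close> is \<open>L\<^sub>0 a\<^sub>1 L\<^sub>1 \<cdots> a\<^sub>n L\<^sub>n\<close>.\<close>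

fun marked_product :: "'a lang \<Rightarrow> ('a \<times> 'a lang) list \<Rightarrow> 'a lang" where
  "marked_product L [] = L"
| "marked_product L ((a, K) # ps) = conc L (conc {[a]} (marked_product K ps))"

definition marked_products :: "'a lang set \<Rightarrow> 'a lang set" where
  "marked_products C = {marked_product L ps | L ps. L \<in> C \<and> snd ` set ps \<subseteq> C}"

definition Pol :: "'a lang set \<Rightarrow> 'a lang set" where
  "Pol C = {\<Union> \<F> | \<F>. finite \<F> \<and> \<F> \<subseteq> marked_products C}"

definition BPol :: "'a lang set \<Rightarrow> 'a lang set" where
  "BPol C = \<Inter> {B. lang_boolean_algebra B \<and> Pol C \<subseteq> B}"


section \<open>Separation\<close>

definition separable :: "'a lang set \<Rightarrow> 'a lang \<Rightarrow> 'a lang \<Rightarrow> bool" where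
  "separable C L0 L1 \<longleftrightarrow> (\<exists>K\<in>C. L0 \<subseteq> K \<and> K \<inter> L1 = {})"

definition separable_under_control ::
    "'a lang set \<Rightarrow> 'a lang set \<Rightarrow> 'a lang \<Rightarrow> 'a lang \<Rightarrow> bool" where
  "separable_under_control C D L0 L1 \<longleftrightarrow> (\<exists>H\<in>D. [] \<in> H \<and> separable C (L0 \<inter> H) (L1 \<inter> H))"

definition inseparable_quads ::
    "'a lang set \<Rightarrow> 'a lang set \<Rightarrow> ('q, 'a) nfa \<Rightarrow> ('q \<times> 'q \<times> 'q \<times> 'q) set" where
  "inseparable_quads C D \<A> =
     {(q, r, s, t) \<in> states \<A> \<times> states \<A> \<times> states \<A> \<times> states \<A>.
        \<not> separable_under_control C D (nfa_lang \<A> q r) (nfa_lang \<A> s t)}"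


section \<open>Sound sets\<close>

definition pump_nfa ::
    "('q, 'a) nfa \<Rightarrow> ('q \<times> 'q \<times> 'q \<times> 'q) set \<Rightarrow> ('q \<times> 'q \<times> 'q, 'a option) nfa" where
  "pump_nfa \<A> S =
     \<lparr>states = states \<A> \<times> states \<A> \<times> states \<A>,
      trans =
        {((s1, s2, s3), Some a, (t1, t2, t3)) | s1 s2 s3 a t1 t2 t3.
           (s1, a, t1) \<in> trans \<A> \<and> (s2, a, t2) \<in> trans \<A> \<and> (s3, a, t3) \<in> trans \<A>} \<union>
        {((q1, q2, q3), None, (q1, r2, r3)) | q1 q2 q3 r2 r3.
           q1 \<in> states \<A> \<and> (q2, r2, q3, r3) \<in> S}\<rparr>"

definition tau ::
    "'a lang set \<Rightarrow> ('q, 'a) nfa \<Rightarrow> ('q \<times> 'q \<times> 'q \<times> 'q) set \<Rightarrow> ('q \<times> 'q \<times> 'q \<times> 'q) set" where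
  "tau \<G> \<A> S =
     {(q, r, s, t) \<in> states \<A> \<times> states \<A> \<times> states \<A> \<times> states \<A>.
        \<not> separable \<G> {[]} (eps_lang (pump_nfa \<A> S) (s, q, s) (t, r, t)) \<and>
        \<not> separable \<G> {[]} (eps_lang (pump_nfa \<A> S) (q, s, q) (r, t, r))}"

definition bpol_sound ::
    "'a lang set \<Rightarrow> ('q, 'a) nfa \<Rightarrow> ('q \<times> 'q \<times> 'q \<times> 'q) set \<Rightarrow> bool" where
  "bpol_sound \<G> \<A> S \<longleftrightarrow>
     S \<subseteq> states \<A> \<times> states \<A> \<times> states \<A> \<times> states \<A> \<and> tau \<G> \<A> S = S"

end

theory Submission
  imports Defs "HOL-Algebra.Multiplicative_Group"
begin

text \<open>
  Fix a finite \<open>F \<subseteq> \<G>\<close> and stratify \<open>Pol\<close> of the \<open>F\<close>-saturated languages by preorders on words,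
  \<open>v \<in> upset F k u\<close> being the preorder of level \<open>k\<close>. The induced equivalences have finitely many
  classes, and the languages of \<open>BPol \<G>\<close> are exactly those saturated by one of them. Hence a
  quadruple is inseparable iff for all \<open>F\<close> and \<open>k\<close> it has a pair of equivalent witnesses in the
  class of \<open>\<epsilon>\<close>.

  Inserting words equivalent to \<open>\<epsilon>\<close> makes a word larger at every level. If \<open>S \<subseteq> tau \<G> \<A> S\<close>, inserting
  ever longer chains therefore produces ascending chains that alternate between the two languages
  of a quadruple of \<open>S\<close>; by finiteness two consecutive elements are equivalent, so the quadruple is
  inseparable.

  Conversely let \<open>u\<close>, \<open>v\<close> be witnesses for an inseparable quadruple at a high level. Cutting loops
  exhibits \<open>v\<close> as a word \<open>w\<close> of bounded length with words equivalent to \<open>\<epsilon>\<close> inserted. Transporting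
  this factorization back and forth between \<open>v\<close> and \<open>u\<close> lets the inserted words grow until they are
  equivalent, so that they witness inseparable quadruples themselves and \<open>w\<close> labels a run of the
  automaton defining \<open>tau\<close>.
\<close>

section \<open>Boolean algebras of languages\<close>

lemma lang_lattice_UN:
  assumes C: "lang_lattice C" and fin: "finite I" and f: "\<And>i. i \<in> I \<Longrightarrow> f i \<in> C"
  shows "(\<Union>i\<in>I. f i) \<in> C"
  using fin f
proof (induction I rule: finite_induct)
  case empty
  then show ?case using C by (simp add: lang_lattice_def)
next
  case (insert i I)
  then show ?case using C by (auto simp: lang_lattice_def)
qed

lemma lang_lattice_INT:
  assumes C: "lang_lattice C" and fin: "finite I" and f: "\<And>i. i \<in> I \<Longrightarrow> f i \<in> C"
  shows "(\<Inter>i\<in>I. f i) \<in> C"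
  using fin f
proof (induction I rule: finite_induct)
  case empty
  then show ?case using C by (simp add: lang_lattice_def)
next
  case (insert i I)
  then show ?case using C by (auto simp: lang_lattice_def)
qed

text \<open>\<open>K\<close> is the union of the atoms of the Boolean algebra generated by
  \<open>\<F>\<close> that it contains; these are indexed by the finitely many subsets of
  \<open>\<F>\<close>.\<close>

lemma saturated_in_boolean_algebra:
  assumes B: "lang_boolean_algebra B" and fin: "finite \<F>" and sub: "\<F> \<subseteq> B"
    and sat: "\<And>u v. (\<forall>X\<in>\<F>. u \<in> X \<longleftrightarrow> v \<in> X) \<Longrightarrow> u \<in> K \<Longrightarrow> v \<in> K"
  shows "K \<in> B"
proof -
  have lat: "lang_lattice B" and comp: "\<And>L. L \<in> B \<Longrightarrow> - L \<in> B"
    using B by (auto simp: lang_boolean_algebra_def)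
  define atom where "atom T = (\<Inter>X\<in>\<F>. if X \<in> T then X else - X)" for T
  have atom: "atom T \<in> B" for T
    unfolding atom_def using sub comp by (intro lang_lattice_INT[OF lat fin]) auto
  have "K = (\<Union>T\<in>{T \<in> Pow \<F>. atom T \<subseteq> K}. atom T)"
  proof (intro equalityI subsetI)
    fix u assume u: "u \<in> K"
    define T where "T = {X \<in> \<F>. u \<in> X}"
    have "atom T \<subseteq> K"
    proof
      fix v assume "v \<in> atom T"
      then have "\<forall>X\<in>\<F>. u \<in> X \<longleftrightarrow> v \<in> X"
        by (auto simp: atom_def T_def split: if_splits)
      then show "v \<in> K" using sat u by blast
    qed
    moreover have "u \<in> atom T" by (auto simp: atom_def T_def)
    moreover have "T \<in> Pow \<F>" by (auto simp: T_def)
    ultimately show "u \<in> (\<Union>T\<in>{T \<in> Pow \<F>. atom T \<subseteq> K}. atom T)"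
      by blast
  qed auto
  moreover have "(\<Union>T\<in>{T \<in> Pow \<F>. atom T \<subseteq> K}. atom T) \<in> B"
    using fin atom by (intro lang_lattice_UN[OF lat]) auto
  ultimately show ?thesis by simp
qed

lemma BPol_boolean_algebra: "lang_boolean_algebra (BPol C)"
  unfolding BPol_def lang_boolean_algebra_def lang_lattice_def by blast

lemma Pol_subset_BPol: "Pol C \<subseteq> BPol C"
  by (auto simp: BPol_def)

lemma separable_commute:
  assumes "lang_boolean_algebra C"
  shows "separable C L0 L1 \<longleftrightarrow> separable C L1 L0"
proof -
  have "separable C L1 L0" if "separable C L0 L1" for L0 L1
  proof -
    obtain K where "K \<in> C" "L0 \<subseteq> K" "K \<inter> L1 = {}"
      using \<open>separable C L0 L1\<close> unfolding separable_def by blast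
    then have "- K \<in> C" "L1 \<subseteq> - K" "- K \<inter> L0 = {}"
      using assms by (auto simp: lang_boolean_algebra_def)
    then show ?thesis unfolding separable_def by blast
  qed
  then show ?thesis by blast
qed

lemma separable_antimono:
  assumes "separable C K L" "L' \<subseteq> L"
  shows "separable C K L'"
proof -
  obtain M where "M \<in> C" "K \<subseteq> M" "M \<inter> L = {}"
    using assms(1) unfolding separable_def by blast
  then have "M \<in> C" "K \<subseteq> M" "M \<inter> L' = {}"
    using assms(2) by auto
  then show ?thesis unfolding separable_def by blast
qed

lemma not_separable_singletonD:
  assumes "\<not> separable C {u} L" "H \<in> C" "u \<in> H"
  obtains w where "w \<in> H" "w \<in> L"
  using assms unfolding separable_def by blast


section \<open>Syntactic congruences\<close>

definition contexts :: "'a lang \<Rightarrow> 'a list \<Rightarrow> ('a list \<times> 'a list) set" where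
  "contexts L u = {(x, y). x @ u @ y \<in> L}"

text \<open>The intersection of the syntactic congruences of the languages in \<open>F\<close>. For
  a finite set of group languages the quotient is a finite group, which
  \<open>finite_synt_classes\<close> and \<open>synt_cancel\<close> exploit on words.\<close>

definition synt :: "'a lang set \<Rightarrow> 'a list \<Rightarrow> 'a list \<Rightarrow> bool" where
  "synt F u v \<longleftrightarrow> (\<forall>L\<in>F. contexts L u = contexts L v)"

text \<open>For finite \<open>F \<subseteq> \<G>\<close> this is a finite Boolean algebra inside
  \<open>\<G>\<close>, closed under quotients; it stands in for \<open>\<G>\<close> at one stage of
  the approximation.\<close>

definition synt_saturated :: "'a lang set \<Rightarrow> 'a lang set" where
  "synt_saturated F = {L. \<forall>u v. synt F u v \<longrightarrow> u \<in> L \<longrightarrow> v \<in> L}"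

lemma contexts_append:
  assumes "contexts L u = contexts L u'" "contexts L v = contexts L v'"
  shows "contexts L (u @ v) = contexts L (u' @ v')"
proof -
  have u: "x @ u @ y \<in> L \<longleftrightarrow> x @ u' @ y \<in> L" and v: "x @ v @ y \<in> L \<longleftrightarrow> x @ v' @ y \<in> L" for x y
    using assms by (auto simp: contexts_def set_eq_iff)
  have "x @ u @ v @ y \<in> L \<longleftrightarrow> x @ u' @ v' @ y \<in> L" for x y
    using u[of x "v @ y"] v[of "x @ u'" y] by simp
  then show ?thesis by (simp add: contexts_def)
qed

lemma synt_refl [simp]: "synt F u u"
  by (simp add: synt_def)

lemma synt_sym: "synt F u v \<Longrightarrow> synt F v u"
  by (simp add: synt_def)

lemma synt_trans [trans]: "synt F u v \<Longrightarrow> synt F v w \<Longrightarrow> synt F u w"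
  by (simp add: synt_def)

lemma synt_append: "synt F u u' \<Longrightarrow> synt F v v' \<Longrightarrow> synt F (u @ v) (u' @ v')"
  unfolding synt_def using contexts_append by blast

lemma synt_Cons: "synt F u v \<Longrightarrow> synt F (a # u) (a # v)"
  using synt_append[of F "[a]" "[a]" u v] by simp

lemma synt_mono: "F \<subseteq> F' \<Longrightarrow> synt F' u v \<Longrightarrow> synt F u v"
  by (auto simp: synt_def)

lemma synt_mem:
  assumes "synt F u v" "L \<in> F"
  shows "u \<in> L \<longleftrightarrow> v \<in> L"
proof -
  have "([], []) \<in> contexts L u \<longleftrightarrow> ([], []) \<in> contexts L v"
    using assms by (simp add: synt_def)
  then show ?thesis by (simp add: contexts_def)
qed

lemma synt_saturated_superset: "F \<subseteq> synt_saturated F"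
  by (auto simp: synt_saturated_def dest: synt_mem)

lemma synt_saturated_lattice: "lang_lattice (synt_saturated F)"
  by (auto simp: synt_saturated_def lang_lattice_def)

lemma synt_class_saturated: "{v. synt F u v} \<in> synt_saturated F"
  by (auto simp: synt_saturated_def intro: synt_trans)

section \<open>Group languages: finite index and cancellation\<close>

lemma group_language_word_hom:
  assumes "group_language L"
  obtains G :: "nat monoid" and \<eta> F where "group G" "finite (carrier G)"
    "\<And>u. \<eta> u \<in> carrier G" "\<And>u v. \<eta> (u @ v) = \<eta> u \<otimes>\<^bsub>G\<^esub> \<eta> v" "\<eta> [] = \<one>\<^bsub>G\<^esub>"
    "\<And>u. u \<in> L \<longleftrightarrow> \<eta> u \<in> F"
proof -
  obtain G :: "nat monoid" and \<eta> F where *: "group G" "finite (carrier G)"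
    "\<eta> \<in> hom word_monoid G" "\<eta> [] = \<one>\<^bsub>G\<^esub>" "L = \<eta> -` F"
    using assms unfolding group_language_def by blast
  show thesis
  proof (rule that)
    show "\<eta> u \<in> carrier G" "\<eta> (u @ v) = \<eta> u \<otimes>\<^bsub>G\<^esub> \<eta> v" for u v
      using *(3) by (auto simp: hom_def word_monoid_def)
  qed (use * in auto)
qed

text \<open>The contexts of \<open>u\<close> depend only on \<open>\<eta> u\<close>, which ranges
  over a finite group.\<close>

lemma finite_contexts:
  assumes "group_language L"
  shows "finite (range (contexts L))"
proof -
  obtain G :: "nat monoid" and \<eta> F where fin: "finite (carrier G)"
    and \<eta>: "\<And>u. \<eta> u \<in> carrier G" "\<And>u v. \<eta> (u @ v) = \<eta> u \<otimes>\<^bsub>G\<^esub> \<eta> v"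
    and L: "\<And>u. u \<in> L \<longleftrightarrow> \<eta> u \<in> F"
    using group_language_word_hom[OF assms] by metis
  have "range (contexts L)
      \<subseteq> (\<lambda>g. {(x, y). \<eta> x \<otimes>\<^bsub>G\<^esub> (g \<otimes>\<^bsub>G\<^esub> \<eta> y) \<in> F}) ` carrier G"
    using \<eta> L by (auto simp: contexts_def)
  then show ?thesis using fin by (meson finite_imageI finite_subset)
qed

lemma finite_two_sided_quotients:
  assumes "group_language L"
  shows "finite (range (\<lambda>(x, y). {w. x @ w @ y \<in> L}))"
proof -
  obtain G :: "nat monoid" and \<eta> F where fin: "finite (carrier G)"
    and \<eta>: "\<And>u. \<eta> u \<in> carrier G" "\<And>u v. \<eta> (u @ v) = \<eta> u \<otimes>\<^bsub>G\<^esub> \<eta> v"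
    and L: "\<And>u. u \<in> L \<longleftrightarrow> \<eta> u \<in> F"
    using group_language_word_hom[OF assms] by metis
  have "range (\<lambda>(x, y). {w. x @ w @ y \<in> L})
      \<subseteq> (\<lambda>(g, h). {w. g \<otimes>\<^bsub>G\<^esub> (\<eta> w \<otimes>\<^bsub>G\<^esub> h) \<in> F}) ` (carrier G \<times> carrier G)"
  proof
    fix X assume "X \<in> range (\<lambda>(x, y). {w. x @ w @ y \<in> L})"
    then obtain x y where "X = {w. x @ w @ y \<in> L}" by auto
    then have "X = (\<lambda>(g, h). {w. g \<otimes>\<^bsub>G\<^esub> (\<eta> w \<otimes>\<^bsub>G\<^esub> h) \<in> F}) (\<eta> x, \<eta> y)"
      by (simp add: L \<eta>)
    then show "X \<in> (\<lambda>(g, h). {w. g \<otimes>\<^bsub>G\<^esub> (\<eta> w \<otimes>\<^bsub>G\<^esub> h) \<in> F}) ` (carrier G \<times> carrier G)"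
      using \<eta>(1) by blast
  qed
  then show ?thesis using fin by (meson finite_SigmaI finite_imageI finite_subset)
qed

text \<open>In a finite group a power of \<open>\<eta> u\<close> is its inverse, and this power is
  the image of a word; prefixing that word cancels \<open>u\<close>. Only contexts are compared,
  since \<open>\<eta> x\<close> need not be the identity.\<close>

lemma contexts_cancel:
  assumes "group_language L" and eq: "contexts L (u @ x) = contexts L u"
  shows "contexts L x = contexts L []"
proof -
  obtain G :: "nat monoid" and \<eta> F where G: "group G" "finite (carrier G)"
    and \<eta>: "\<And>u. \<eta> u \<in> carrier G" "\<And>u v. \<eta> (u @ v) = \<eta> u \<otimes>\<^bsub>G\<^esub> \<eta> v" "\<eta> [] = \<one>\<^bsub>G\<^esub>"
    and L: "\<And>u. u \<in> L \<longleftrightarrow> \<eta> u \<in> F"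
    using group_language_word_hom[OF assms(1)] by metis
  interpret group G by fact
  define p where "p n = concat (replicate n u)" for n :: nat
  have \<eta>p: "\<eta> (p n) = \<eta> u [^]\<^bsub>G\<^esub> n" for n
  proof (induction n)
    case 0
    then show ?case by (simp add: p_def \<eta>)
  next
    case (Suc n)
    then have "\<eta> (p (Suc n)) = \<eta> u \<otimes>\<^bsub>G\<^esub> \<eta> u [^]\<^bsub>G\<^esub> n"
      by (simp add: p_def \<eta>)
    then show ?case by (simp only: nat_pow_Suc2[OF \<eta>(1)])
  qed
  have "order G > 0"
    using G order_gt_0_iff_finite by blast
  then obtain m where m: "order G = Suc m"
    by (cases "order G") auto
  have "\<eta> (p m @ u) = \<one>\<^bsub>G\<^esub>"
    using pow_order_eq_1[OF \<eta>(1)[of u]] by (simp add: \<eta>p \<eta>(2) m)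
  then have one: "a @ b \<in> L \<longleftrightarrow> a @ (p m @ u) @ b \<in> L" for a b
    by (simp only: L \<eta>(2)) (simp add: \<eta>(1))
  have ux: "a @ (u @ x) @ b \<in> L \<longleftrightarrow> a @ u @ b \<in> L" for a b
    using eq by (auto simp: contexts_def set_eq_iff)
  \<comment> \<open>Insert \<open>p m @ u\<close> in front of \<open>x\<close>, delete
    \<open>x\<close> by \<open>ux\<close> in the context \<open>(a @ p m, b)\<close>, and remove the
    inserted word again.\<close>
  have "a @ x @ b \<in> L \<longleftrightarrow> a @ [] @ b \<in> L" for a b
    using one[of a "x @ b"] ux[of "a @ p m" b] one[of a b] by simp
  then show ?thesis by (simp add: contexts_def)
qed

lemma synt_cancel:
  assumes "\<forall>L\<in>F. group_language L" "synt F u (u @ x)"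
  shows "synt F [] x"
  using assms contexts_cancel unfolding synt_def by metis

lemma finite_synt_classes:
  assumes "finite F" "\<forall>L\<in>F. group_language L"
  shows "finite (range (\<lambda>u. {v. synt F u v}))"
proof -
  have "range (\<lambda>u. {v. synt F u v})
      \<subseteq> (\<lambda>\<phi>. {v. \<forall>L\<in>F. \<phi> L = contexts L v}) ` (\<Pi>\<^sub>E L\<in>F. range (contexts L))"
  proof
    fix X assume "X \<in> range (\<lambda>u. {v. synt F u v})"
    then obtain u where "X = {v. synt F u v}" by blast
    then have "X = {v. \<forall>L\<in>F. restrict (\<lambda>L. contexts L u) F L = contexts L v}"
      by (simp add: synt_def)
    moreover have "restrict (\<lambda>L. contexts L u) F \<in> (\<Pi>\<^sub>E L\<in>F. range (contexts L))"
      by simp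
    ultimately show "X \<in> (\<lambda>\<phi>. {v. \<forall>L\<in>F. \<phi> L = contexts L v}) ` (\<Pi>\<^sub>E L\<in>F. range (contexts L))"
      by (rule image_eqI)
  qed
  moreover have "finite (\<Pi>\<^sub>E L\<in>F. range (contexts L))"
    using assms by (intro finite_PiE finite_contexts) auto
  ultimately show ?thesis by (meson finite_imageI finite_subset)
qed

lemma group_prevarietyD:
  assumes "group_prevariety \<G>"
  shows "lang_boolean_algebra \<G>" "quotient_closed \<G>" "L \<in> \<G> \<Longrightarrow> group_language L"
  using assms by (auto simp: group_prevariety_def prevariety_def)

text \<open>Words are related by \<open>synt F\<close> when they agree on all two-sided quotients of
  languages in \<open>F\<close>. These quotients lie in \<open>\<G>\<close> and, for group
  languages, are finitely many.\<close>

lemma synt_saturated_subset: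
  assumes \<G>: "group_prevariety \<G>" and F: "finite F" "F \<subseteq> \<G>"
  shows "synt_saturated F \<subseteq> \<G>"
proof
  fix K assume K: "K \<in> synt_saturated F"
  define \<F> where "\<F> = (\<Union>L\<in>F. range (\<lambda>(x, y). {w. x @ w @ y \<in> L}))"
  have "finite \<F>"
    unfolding \<F>_def using F group_prevarietyD(3)[OF \<G>] by (intro finite_UN_I finite_two_sided_quotients) auto
  moreover have "\<F> \<subseteq> \<G>"
  proof -
    have "{w. x @ w @ y \<in> L} \<in> \<G>" if "L \<in> F" for x y L
    proof -
      have "right_quotient (left_quotient x L) y \<in> \<G>"
        using that F group_prevarietyD(2)[OF \<G>] unfolding quotient_closed_def by blast
      then show ?thesis by (simp add: left_quotient_def right_quotient_def)
    qed
    then show ?thesis unfolding \<F>_def by auto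
  qed
  moreover have "v \<in> K" if uv: "\<forall>X\<in>\<F>. u \<in> X \<longleftrightarrow> v \<in> X" and "u \<in> K" for u v
  proof -
    have "x @ u @ y \<in> L \<longleftrightarrow> x @ v @ y \<in> L" if "L \<in> F" for L x y
    proof -
      have "{w. x @ w @ y \<in> L} \<in> \<F>" using that by (auto simp: \<F>_def)
      then show ?thesis using uv by fastforce
    qed
    then have "synt F u v" by (auto simp: synt_def contexts_def)
    then show ?thesis using K \<open>u \<in> K\<close> by (auto simp: synt_saturated_def)
  qed
  ultimately show "K \<in> \<G>"
    using saturated_in_boolean_algebra[OF group_prevarietyD(1)[OF \<G>]] by blast
qed


section \<open>Polynomial closure\<close>

abbreviation mark :: "'a \<Rightarrow> 'a lang \<Rightarrow> 'a lang \<Rightarrow> 'a lang" where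
  "mark a K L \<equiv> conc K (conc {[a]} L)"

lemma mark_iff: "w \<in> mark a K L \<longleftrightarrow> (\<exists>u v. w = u @ a # v \<and> u \<in> K \<and> v \<in> L)"
  by (auto simp: conc_def)

lemma markI: "u \<in> K \<Longrightarrow> v \<in> L \<Longrightarrow> u @ a # v \<in> mark a K L"
  by (auto simp: mark_iff)

lemma markE:
  assumes "w \<in> mark a K L"
  obtains u v where "w = u @ a # v" "u \<in> K" "v \<in> L"
  using assms by (auto simp: mark_iff)

lemma Pol_mono:
  assumes "C \<subseteq> D"
  shows "Pol C \<subseteq> Pol D"
proof -
  have "marked_products C \<subseteq> marked_products D"
    using assms unfolding marked_products_def by (smt (verit) Collect_mono subset_iff)
  then show ?thesis unfolding Pol_def by (smt (verit) Collect_mono subset_trans)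
qed

lemma marked_product_in_Pol: "L \<in> C \<Longrightarrow> snd ` set ps \<subseteq> C \<Longrightarrow> marked_product L ps \<in> Pol C"
proof -
  assume "L \<in> C" "snd ` set ps \<subseteq> C"
  then have "{marked_product L ps} \<subseteq> marked_products C"
    unfolding marked_products_def by blast
  moreover have "marked_product L ps = \<Union> {marked_product L ps}" by simp
  ultimately show ?thesis unfolding Pol_def by blast
qed

lemma subset_Pol: "C \<subseteq> Pol C"
  using marked_product_in_Pol[of _ C "[]"] by auto

lemma Pol_Un:
  assumes "K \<in> Pol C" "L \<in> Pol C"
  shows "K \<union> L \<in> Pol C"
proof -
  obtain \<F> \<F>' where "finite \<F>" "\<F> \<subseteq> marked_products C" "K = \<Union> \<F>"
    "finite \<F>'" "\<F>' \<subseteq> marked_products C" "L = \<Union> \<F>'"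
    using assms unfolding Pol_def by blast
  then have "finite (\<F> \<union> \<F>')" "\<F> \<union> \<F>' \<subseteq> marked_products C" "K \<union> L = \<Union> (\<F> \<union> \<F>')"
    by auto
  then show ?thesis unfolding Pol_def by blast
qed

lemma Pol_empty: "{} \<in> Pol C"
  unfolding Pol_def by blast

lemma Pol_UN:
  assumes "finite I" "\<And>i. i \<in> I \<Longrightarrow> f i \<in> Pol C"
  shows "(\<Union>i\<in>I. f i) \<in> Pol C"
  using assms by (induction I rule: finite_induct) (auto simp: Pol_empty intro: Pol_Un)

text \<open>Reduces closure of \<open>Pol C\<close> under an operation distributing over unions to
  the case of marked products; used for \<open>mark\<close> and for intersection.\<close>

lemma Pol_bilinear:
  assumes f: "\<And>\<K> \<L>. f (\<Union> \<K>) (\<Union> \<L>) = (\<Union>K\<in>\<K>. \<Union>L\<in>\<L>. f K L)"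
    and prod: "\<And>K L. K \<in> marked_products C \<Longrightarrow> L \<in> marked_products C \<Longrightarrow> f K L \<in> Pol C"
    and KL: "K \<in> Pol C" "L \<in> Pol C"
  shows "f K L \<in> Pol C"
proof -
  obtain \<K> where K: "finite \<K>" "\<K> \<subseteq> marked_products C" "K = \<Union> \<K>"
    using KL(1) unfolding Pol_def by blast
  obtain \<L> where L: "finite \<L>" "\<L> \<subseteq> marked_products C" "L = \<Union> \<L>"
    using KL(2) unfolding Pol_def by blast
  have "(\<Union>K\<in>\<K>. \<Union>L\<in>\<L>. f K L) \<in> Pol C"
    using K L by (intro Pol_UN prod) auto
  then show ?thesis by (simp only: K L f)
qed

lemma concI: "u \<in> K \<Longrightarrow> v \<in> L \<Longrightarrow> u @ v \<in> conc K L"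
  by (auto simp: conc_def)

lemma concE:
  assumes "w \<in> conc K L"
  obtains u v where "w = u @ v" "u \<in> K" "v \<in> L"
  using assms by (auto simp: conc_def)

lemma conc_assoc: "conc (conc K L) M = conc K (conc L M)"
proof (intro equalityI subsetI)
  fix w assume "w \<in> conc (conc K L) M"
  then obtain x y z where "w = (x @ y) @ z" "x \<in> K" "y \<in> L" "z \<in> M"
    by (metis concE)
  then show "w \<in> conc K (conc L M)"
    by (simp add: concI)
next
  fix w assume "w \<in> conc K (conc L M)"
  then obtain x y z where w: "w = x @ y @ z" "x \<in> K" "y \<in> L" "z \<in> M"
    by (metis concE)
  then have "(x @ y) @ z \<in> conc (conc K L) M"
    by (intro concI)
  then show "w \<in> conc (conc K L) M"
    using w by simp
qed

lemma mark_marked_product: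
  "mark a (marked_product K ps) (marked_product L qs) = marked_product K (ps @ (a, L) # qs)"
proof (induction ps arbitrary: K)
  case Nil
  then show ?case by simp
next
  case (Cons p ps)
  then show ?case by (cases p) (simp add: conc_assoc)
qed

lemma Pol_mark:
  assumes "K \<in> Pol C" "L \<in> Pol C"
  shows "mark a K L \<in> Pol C"
proof (rule Pol_bilinear[OF _ _ assms])
  show "mark a (\<Union> \<K>) (\<Union> \<L>) = (\<Union>K\<in>\<K>. \<Union>L\<in>\<L>. mark a K L)" for \<K> \<L>
    by (auto elim!: markE intro: markI)
  show "mark a K L \<in> Pol C" if KL: "K \<in> marked_products C" "L \<in> marked_products C" for K L
  proof -
    obtain K' ps L' qs where "K = marked_product K' ps" "K' \<in> C" "snd ` set ps \<subseteq> C"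
      "L = marked_product L' qs" "L' \<in> C" "snd ` set qs \<subseteq> C"
      using KL unfolding marked_products_def by blast
    then show ?thesis
      using marked_product_in_Pol[of K' C "ps @ (a, L') # qs"]
      by (simp add: mark_marked_product image_Un)
  qed
qed

section \<open>Closure of the polynomial closure under intersection\<close>

definition class_quotient :: "'a lang \<Rightarrow> 'a \<Rightarrow> 'a lang \<Rightarrow> 'a lang" where
  "class_quotient c a L = {w. \<exists>u\<in>c. u @ a # w \<in> L}"

lemma class_quotient_saturated:
  "L \<in> synt_saturated F \<Longrightarrow> class_quotient c a L \<in> synt_saturated F"
proof -
  assume L: "L \<in> synt_saturated F"
  have "x @ a # v \<in> L" if "synt F u v" "x @ a # u \<in> L" for u v x
    using L that synt_append[OF synt_refl synt_Cons[OF that(1)], of x a]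
    unfolding synt_saturated_def by simp
  then show ?thesis unfolding synt_saturated_def class_quotient_def by auto
qed

text \<open>Saturation makes the choice of a representative irrelevant:
  \<open>class_quotient\<close> is the left quotient by \<open>u @ [a]\<close> for any one
  \<open>u\<close> of the class.\<close>

lemma class_quotient_iff:
  assumes L: "L \<in> synt_saturated F" and u: "synt F v u"
  shows "w \<in> class_quotient {u. synt F v u} a L \<longleftrightarrow> u @ a # w \<in> L"
proof
  assume "w \<in> class_quotient {u. synt F v u} a L"
  then obtain u' where u': "synt F v u'" "u' @ a # w \<in> L"
    by (auto simp: class_quotient_def)
  have "synt F (u' @ a # w) (u @ a # w)"
    using u u'(1) by (intro synt_append synt_refl) (blast intro: synt_trans synt_sym)
  then show "u @ a # w \<in> L" using L u'(2) by (auto simp: synt_saturated_def)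
qed (use u in \<open>auto simp: class_quotient_def\<close>)

text \<open>
  In a word with two marked factorizations the shorter prefix matters to the other
  factorization only through its class, and there are finitely many classes.
\<close>

lemma mark_Int_mark:
  assumes K: "K \<in> synt_saturated F" and L: "L \<in> synt_saturated F"
  defines "\<C> \<equiv> range (\<lambda>u. {v. synt F u v})"
  shows "mark a K M \<inter> mark b L N =
    (if a = b then mark a (K \<inter> L) (M \<inter> N) else {}) \<union>
    (\<Union>c\<in>\<C>. mark a (K \<inter> c) (M \<inter> mark b (class_quotient c a L) N)) \<union>
    (\<Union>c\<in>\<C>. mark b (L \<inter> c) (mark a (class_quotient c b K) M \<inter> N))"
    (is "?l = ?eq \<union> ?left \<union> ?right")
proof (intro equalityI subsetI)
  fix w assume "w \<in> ?l"
  then obtain k m l n where w: "w = k @ a # m" "w = l @ b # n"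
    and mem: "k \<in> K" "m \<in> M" "l \<in> L" "n \<in> N"
    by (elim IntE markE) blast
  consider "k = l" "a = b" "m = n" | z where "l = k @ a # z" "m = z @ b # n"
    | z where "k = l @ b # z" "n = z @ a # m"
    using w by (auto simp: append_eq_append_conv2 append_eq_Cons_conv Cons_eq_append_conv)
  then show "w \<in> ?eq \<union> ?left \<union> ?right"
  proof cases
    case 1
    then have "w \<in> ?eq" using w mem by (auto simp: mark_iff)
    then show ?thesis by blast
  next
    case 2
    let ?c = "{v. synt F k v}"
    have "z \<in> class_quotient ?c a L"
      using class_quotient_iff[OF L synt_refl] 2 mem by simp
    then have "m \<in> mark b (class_quotient ?c a L) N"
      using markI[of z _ n] 2 mem by simp
    then have "k @ a # m \<in> mark a (K \<inter> ?c) (M \<inter> mark b (class_quotient ?c a L) N)"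
      using mem by (intro markI) auto
    then show ?thesis unfolding \<C>_def w(1) by blast
  next
    case 3
    let ?c = "{v. synt F l v}"
    have "z \<in> class_quotient ?c b K"
      using class_quotient_iff[OF K synt_refl] 3 mem by simp
    then have "n \<in> mark a (class_quotient ?c b K) M"
      using markI[of z _ m] 3 mem by simp
    then have "l @ b # n \<in> mark b (L \<inter> ?c) (mark a (class_quotient ?c b K) M \<inter> N)"
      using mem by (intro markI) auto
    then show ?thesis unfolding \<C>_def w(2) by blast
  qed
next
  fix w assume "w \<in> ?eq \<union> ?left \<union> ?right"
  then consider "w \<in> ?eq" | "w \<in> ?left" | "w \<in> ?right" by blast
  then show "w \<in> ?l"
  proof cases
    case 1
    then show ?thesis by (auto elim!: markE intro: markI split: if_splits)
  next
    case 2
    then obtain x k z n where "w = k @ a # z @ b # n" "k \<in> K" "z @ b # n \<in> M" "n \<in> N"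
      and z: "synt F x k" "z \<in> class_quotient {v. synt F x v} a L"
      unfolding \<C>_def by (auto elim!: markE)
    moreover have "k @ a # z \<in> L"
      using class_quotient_iff[OF L z(1)] z(2) by simp
    ultimately show ?thesis
      using markI[of k K "z @ b # n" M a] markI[of "k @ a # z" L n N b] by simp
  next
    case 3
    then obtain x l z m where "w = l @ b # z @ a # m" "l \<in> L" "z @ a # m \<in> N" "m \<in> M"
      and z: "synt F x l" "z \<in> class_quotient {v. synt F x v} b K"
      unfolding \<C>_def by (auto elim!: markE)
    moreover have "l @ b # z \<in> K"
      using class_quotient_iff[OF K z(1)] z(2) by simp
    ultimately show ?thesis
      using markI[of l L "z @ a # m" N b] markI[of "l @ b # z" K m M a] by simp
  qed
qed

text \<open>The counterpart of \<open>mark_Int_mark\<close> with a marked letter on one side only: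
  once the class of the prefix before \<open>b\<close> is fixed, membership in \<open>K\<close> is a
  condition on the suffix alone.\<close>

lemma Int_mark:
  assumes K: "K \<in> synt_saturated F"
  shows "K \<inter> mark b L N =
    (\<Union>c\<in>range (\<lambda>u. {v. synt F u v}). mark b (L \<inter> c) (class_quotient c b K \<inter> N))" (is "_ = ?r")
proof (intro equalityI subsetI)
  fix w assume "w \<in> K \<inter> mark b L N"
  then obtain l n where w: "w = l @ b # n" "w \<in> K" "l \<in> L" "n \<in> N"
    by (auto elim: markE)
  then have "n \<in> class_quotient {v. synt F l v} b K"
    using class_quotient_iff[OF K synt_refl] by simp
  then have "l @ b # n \<in> mark b (L \<inter> {v. synt F l v}) (class_quotient {v. synt F l v} b K \<inter> N)"
    using w by (intro markI) auto
  then show "w \<in> ?r" unfolding w(1) by blast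
next
  fix w assume "w \<in> ?r"
  then obtain x l n where "w = l @ b # n" "l \<in> L" "n \<in> N"
    "synt F x l" "n \<in> class_quotient {v. synt F x v} b K"
    by (auto elim!: markE)
  then show "w \<in> K \<inter> mark b L N"
    using class_quotient_iff[OF K] by (simp add: markI)
qed

text \<open>Induction on the total number of marked letters: \<open>mark_Int_mark\<close> and
  \<open>Int_mark\<close> move the leftmost marked letter outside and leave intersections of
  products with fewer marked letters in total.\<close>

lemma marked_product_Int:
  assumes F: "finite F" "\<forall>L\<in>F. group_language L"
  defines "C \<equiv> synt_saturated F"
  shows "K \<in> C \<Longrightarrow> snd ` set ps \<subseteq> C \<Longrightarrow> L \<in> C \<Longrightarrow> snd ` set qs \<subseteq> C \<Longrightarrow>
    marked_product K ps \<inter> marked_product L qs \<in> Pol C"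
proof (induction "length ps + length qs" arbitrary: K L ps qs rule: less_induct)
  case less
  let ?cls = "range (\<lambda>u. {v. synt F u v})"
  have Int: "X \<inter> Y \<in> C" if "X \<in> C" "Y \<in> C" for X Y
    using that synt_saturated_lattice[of F] by (auto simp: C_def lang_lattice_def)
  have restrict: "X \<inter> c \<in> Pol C" if "X \<in> C" "c \<in> ?cls" for X c
  proof -
    have "c \<in> C" using that(2) synt_class_saturated[of F] by (auto simp: C_def)
    then show ?thesis using Int that(1) subset_Pol by blast
  qed
  have quot: "class_quotient c a X \<in> C" if "X \<in> C" for c a X
    using that class_quotient_saturated by (auto simp: C_def)
  note UN = Pol_UN[OF finite_synt_classes[OF F]]
  \<comment> \<open>Stated for arbitrary outer languages, so that it serves both when
    \<open>ps\<close> and when \<open>qs\<close> is empty.\<close>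
  have base: "K \<inter> marked_product L ((b, L') # qs') \<in> Pol C"
    if "length qs' < length ps + length qs" "K \<in> C" "L \<in> C" "L' \<in> C" "snd ` set qs' \<subseteq> C"
    for K L L' b qs'
  proof -
    have "class_quotient c b K \<inter> marked_product L' qs' \<in> Pol C" for c
      using less.hyps[of "[]" qs' "class_quotient c b K" L'] that quot by simp
    then have "(\<Union>c\<in>?cls. mark b (L \<inter> c) (class_quotient c b K \<inter> marked_product L' qs')) \<in> Pol C"
      using restrict[OF \<open>L \<in> C\<close>] by (intro UN Pol_mark)
    then show ?thesis
      using that Int_mark[of K F L b "marked_product L' qs'"] by (simp add: C_def)
  qed
  show ?case
  proof (cases ps)
    case Nil
    show ?thesis
    proof (cases qs)
      case Nil
      then show ?thesis using \<open>ps = []\<close> less.prems Int subset_Pol by auto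
    next
      case (Cons q qs')
      then show ?thesis using \<open>ps = []\<close> less.prems base by (cases q) auto
    qed
  next
    case (Cons p ps')
    then obtain a K' where ps: "ps = (a, K') # ps'" by (cases p) auto
    show ?thesis
    proof (cases qs)
      case Nil
      then show ?thesis
        using base[of ps' L K K' a] less.prems ps by (simp add: Int_commute)
    next
      case (Cons q qs')
      then obtain b L' where qs: "qs = (b, L') # qs'" by (cases q) auto
      let ?M = "marked_product K' ps'" and ?N = "marked_product L' qs'"
      have "K \<inter> L \<in> Pol C"
        using Int[OF less.prems(1,3)] subset_Pol[of C] by (rule rev_subsetD)
      moreover have "?M \<inter> ?N \<in> Pol C"
        using less.prems ps qs by (intro less.hyps) auto
      ultimately have eq: "(if a = b then mark a (K \<inter> L) (?M \<inter> ?N) else {}) \<in> Pol C"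
        by (simp add: Pol_empty Pol_mark)
      have "?M \<inter> mark b (class_quotient c a L) ?N \<in> Pol C" for c
        using less.hyps[of ps' qs K' "class_quotient c a L"] less.prems ps qs quot by simp
      then have left: "(\<Union>c\<in>?cls. mark a (K \<inter> c) (?M \<inter> mark b (class_quotient c a L) ?N)) \<in> Pol C"
        using restrict[OF less.prems(1)] by (intro UN Pol_mark)
      have "mark a (class_quotient c b K) ?M \<inter> ?N \<in> Pol C" for c
        using less.hyps[of ps qs' "class_quotient c b K" L'] less.prems ps qs quot by simp
      then have right: "(\<Union>c\<in>?cls. mark b (L \<inter> c) (mark a (class_quotient c b K) ?M \<inter> ?N)) \<in> Pol C"
        using restrict[OF less.prems(3)] by (intro UN Pol_mark)
      have "mark a K ?M \<inter> mark b L ?N \<in> Pol C"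
        using Pol_Un[OF Pol_Un[OF eq left] right]
        unfolding mark_Int_mark[OF less.prems(1,3)[unfolded C_def]] .
      then show ?thesis using ps qs by simp
    qed
  qed
qed

lemma Pol_synt_saturated_lattice:
  assumes "finite F" "\<forall>L\<in>F. group_language L"
  shows "lang_lattice (Pol (synt_saturated F))"
proof -
  have "K \<inter> L \<in> Pol (synt_saturated F)"
    if KL: "K \<in> Pol (synt_saturated F)" "L \<in> Pol (synt_saturated F)" for K L
  proof (rule Pol_bilinear[OF _ _ KL])
    show "\<Union> \<K> \<inter> \<Union> \<L> = (\<Union>K\<in>\<K>. \<Union>L\<in>\<L>. K \<inter> L)" for \<K> \<L> :: "'a lang set"
      by blast
    show "K \<inter> L \<in> Pol (synt_saturated F)"
      if "K \<in> marked_products (synt_saturated F)" "L \<in> marked_products (synt_saturated F)" for K L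
      using that marked_product_Int[OF assms] by (auto simp: marked_products_def)
  qed
  then show ?thesis
    using Pol_Un Pol_empty subset_Pol[of "synt_saturated F"] synt_saturated_lattice[of F]
    by (auto simp: lang_lattice_def)
qed


section \<open>Stratification of the polynomial closure\<close>

text \<open>An Ehrenfeucht-Fraisse style game: each letter of \<open>u\<close> must be answered by
  an equal letter of \<open>v\<close>, and a move costs one level. Letters of \<open>v\<close> need
  no answer, so this is a preorder and not an equivalence.\<close>

fun upset :: "'a lang set \<Rightarrow> nat \<Rightarrow> 'a list \<Rightarrow> 'a lang" where
  "upset F 0 u = {v. synt F u v}"
| "upset F (Suc k) u =
     upset F k u \<inter> (\<Inter>(x, a, y)\<in>{(x, a, y). u = x @ a # y}. mark a (upset F k x) (upset F k y))"

lemma upset_SucI: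
  assumes "v \<in> upset F k u"
    and "\<And>x a y. u = x @ a # y \<Longrightarrow> \<exists>x' y'. v = x' @ a # y' \<and> x' \<in> upset F k x \<and> y' \<in> upset F k y"
  shows "v \<in> upset F (Suc k) u"
  using assms by (auto simp: mark_iff)

lemma upset_SucE:
  assumes "v \<in> upset F (Suc k) (x @ a # y)"
  obtains x' y' where "v = x' @ a # y'" "x' \<in> upset F k x" "y' \<in> upset F k y"
proof -
  have "v \<in> mark a (upset F k x) (upset F k y)"
    using assms by fastforce
  then show thesis using that by (rule markE)
qed

lemma upset_Suc_subset: "upset F (Suc k) u \<subseteq> upset F k u"
  by simp

declare upset.simps(2) [simp del]

lemma upset_antimono: "k \<le> k' \<Longrightarrow> upset F k' u \<subseteq> upset F k u"
proof (induction rule: dec_induct)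
  case (step n)
  then show ?case using upset_Suc_subset by blast
qed simp

lemma upset_synt: "v \<in> upset F k u \<Longrightarrow> synt F u v"
  using upset_antimono[of 0 k F u] by auto

lemma upset_refl: "u \<in> upset F k u"
proof (induction k arbitrary: u)
  case (Suc k)
  then show ?case by (intro upset_SucI) blast+
qed simp

lemma upset_trans: "v \<in> upset F k u \<Longrightarrow> w \<in> upset F k v \<Longrightarrow> w \<in> upset F k u"
proof (induction k arbitrary: u v w)
  case 0
  then show ?case by (auto intro: synt_trans)
next
  case (Suc k)
  show ?case
  proof (rule upset_SucI)
    show "w \<in> upset F k u" using Suc upset_Suc_subset by blast
    show "\<exists>x' y'. w = x' @ a # y' \<and> x' \<in> upset F k x \<and> y' \<in> upset F k y" if "u = x @ a # y" for x a y
      using Suc that by (metis upset_SucE)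
  qed
qed

lemma upset_eq_iff: "upset F k u = upset F k v \<longleftrightarrow> v \<in> upset F k u \<and> u \<in> upset F k v"
  using upset_refl upset_trans by blast

lemma upset_mono: "F \<subseteq> F' \<Longrightarrow> upset F' k u \<subseteq> upset F k u"
proof (induction k arbitrary: u)
  case 0
  then show ?case by (auto intro: synt_mono)
next
  case (Suc k)
  show ?case
  proof
    fix v assume v: "v \<in> upset F' (Suc k) u"
    show "v \<in> upset F (Suc k) u"
    proof (rule upset_SucI)
      show "v \<in> upset F k u" using Suc v upset_Suc_subset by blast
      fix x a y assume "u = x @ a # y"
      then obtain x' y' where "v = x' @ a # y'" "x' \<in> upset F' k x" "y' \<in> upset F' k y"
        using v by (auto elim: upset_SucE)
      then show "\<exists>x' y'. v = x' @ a # y' \<and> x' \<in> upset F k x \<and> y' \<in> upset F k y"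
        using Suc.IH[OF Suc.prems] by auto
    qed
  qed
qed

lemma upset_eq_mono:
  assumes "F \<subseteq> F'" "k \<le> k'" "upset F' k' u = upset F' k' v"
  shows "upset F k u = upset F k v"
  using assms upset_mono[OF assms(1)] upset_antimono[OF assms(2)] unfolding upset_eq_iff by blast

text \<open>A letter of \<open>u @ v\<close> lies in one of the two words and is answered there; the
  other word is carried along one level lower.\<close>

lemma upset_append: "u' \<in> upset F k u \<Longrightarrow> v' \<in> upset F k v \<Longrightarrow> u' @ v' \<in> upset F k (u @ v)"
proof (induction k arbitrary: u u' v v')
  case 0
  then show ?case by (auto intro: synt_append)
next
  case (Suc k)
  show ?case
  proof (rule upset_SucI)
    show "u' @ v' \<in> upset F k (u @ v)" using Suc upset_Suc_subset by blast
    fix x a y assume "u @ v = x @ a # y"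
    then consider z where "u = x @ a # z" "y = z @ v" | z where "x = u @ z" "v = z @ a # y"
      by (auto simp: append_eq_append_conv2 append_eq_Cons_conv)
    then show "\<exists>x' y'. u' @ v' = x' @ a # y' \<and> x' \<in> upset F k x \<and> y' \<in> upset F k y"
    proof cases
      case 1
      then obtain x' z' where "u' = x' @ a # z'" "x' \<in> upset F k x" "z' \<in> upset F k z"
        using Suc.prems by (auto elim: upset_SucE)
      then show ?thesis
        using 1 Suc.IH[of z' z v' v] Suc.prems upset_Suc_subset
        by (intro exI[of _ x'] exI[of _ "z' @ v'"]) auto
    next
      case 2
      then obtain z' y' where "v' = z' @ a # y'" "z' \<in> upset F k z" "y' \<in> upset F k y"
        using Suc.prems by (auto elim: upset_SucE)
      then show ?thesis
        using 2 Suc.IH[of u' u z' z] Suc.prems upset_Suc_subset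
        by (intro exI[of _ "u' @ z'"] exI[of _ y']) auto
    qed
  qed
qed

lemma upset_Cons: "v \<in> upset F k u \<Longrightarrow> a # v \<in> upset F k (a # u)"
  using upset_append[OF upset_refl, of v F k u "[a]"] by simp

text \<open>\<open>[]\<close> offers no letter to answer, so only the condition of level 0 remains.
  With \<open>upset_append\<close>, inserting words equivalent to \<open>[]\<close> therefore moves
  a word up at every level.\<close>

lemma synt_Nil_upset: "synt F [] u \<Longrightarrow> u \<in> upset F k []"
  by (induction k) (auto intro: upset_SucI)

text \<open>An up-set of level \<open>k + 1\<close> is determined by one of level \<open>k\<close>
  and a set of triples made of two up-sets of level \<open>k\<close> and a letter.\<close>

lemma finite_upset:
  fixes F :: "('a :: finite) lang set"
  assumes F: "finite F" "\<forall>L\<in>F. group_language L"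
  shows "finite (range (upset F k))"
proof (induction k)
  case 0
  then show ?case using finite_synt_classes[OF F] by simp
next
  case (Suc k)
  let ?R = "range (upset F k)"
  have "upset F (Suc k) u \<in> (\<lambda>(X, T). X \<inter> (\<Inter>(Y, a, Z)\<in>T. mark a Y Z)) ` (?R \<times> Pow (?R \<times> UNIV \<times> ?R))" for u
  proof -
    have "upset F (Suc k) u = (\<lambda>(X, T). X \<inter> (\<Inter>(Y, a, Z)\<in>T. mark a Y Z))
        (upset F k u, (\<lambda>(x, a, y). (upset F k x, a, upset F k y)) ` {(x, a, y). u = x @ a # y})"
      by (auto simp: upset.simps(2))
    then show ?thesis by (rule image_eqI) auto
  qed
  then have "range (upset F (Suc k)) \<subseteq>
      (\<lambda>(X, T). X \<inter> (\<Inter>(Y, a, Z)\<in>T. mark a Y Z)) ` (?R \<times> Pow (?R \<times> UNIV \<times> ?R))"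
    by blast
  moreover have "finite (?R \<times> Pow (?R \<times> (UNIV :: 'a set) \<times> ?R))"
    using Suc by simp
  ultimately show ?case by (meson finite_imageI finite_subset)
qed

section \<open>Up-sets and the languages of \<open>BPol\<close>\<close>

lemma finite_marked_factorizations: "finite {(x, a, y). u = x @ a # y}"
proof (rule finite_subset)
  show "{(x, a, y). u = x @ a # y} \<subseteq> (\<lambda>n. (take n u, u ! n, drop (Suc n) u)) ` {..<length u}"
    by (force simp: image_iff Bex_def nth_append)
qed simp

text \<open>The recursion is a finite intersection, one marked product per position of
  \<open>u\<close>, and \<open>Pol (synt_saturated F)\<close> is a lattice.\<close>

lemma upset_in_Pol:
  assumes F: "finite F" "\<forall>L\<in>F. group_language L"
  shows "upset F k u \<in> Pol (synt_saturated F)"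
proof (induction k arbitrary: u)
  case 0
  then show ?case using synt_class_saturated subset_Pol by fastforce
next
  case (Suc k)
  note lat = Pol_synt_saturated_lattice[OF F]
  have "(\<Inter>(x, a, y)\<in>{(x, a, y). u = x @ a # y}. mark a (upset F k x) (upset F k y)) \<in> Pol (synt_saturated F)"
    using Suc by (intro lang_lattice_INT[OF lat finite_marked_factorizations]) (auto intro!: Pol_mark)
  then show ?case
    using Suc lat unfolding upset.simps(2) lang_lattice_def by blast
qed

text \<open>The marked letters are answered from left to right at the cost of one level each, so
  \<open>length ps\<close> levels suffice.\<close>

lemma marked_product_upset_closed:
  assumes "L \<in> synt_saturated F" "snd ` set ps \<subseteq> synt_saturated F"
    and "u \<in> marked_product L ps" "v \<in> upset F (length ps) u"
  shows "v \<in> marked_product L ps"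
  using assms
proof (induction ps arbitrary: L u v)
  case Nil
  then show ?case by (auto simp: synt_saturated_def)
next
  case (Cons p ps)
  obtain a L' where p: "p = (a, L')" by (cases p)
  obtain x y where u: "u = x @ a # y" and x: "x \<in> L" and y: "y \<in> marked_product L' ps"
    using Cons.prems(3) by (auto simp: p elim: markE)
  then have "v \<in> upset F (Suc (length ps)) (x @ a # y)"
    using Cons.prems(4) by simp
  then obtain x' y' where v: "v = x' @ a # y'"
    and x': "x' \<in> upset F (length ps) x" and y': "y' \<in> upset F (length ps) y"
    by (rule upset_SucE)
  have "x' \<in> L"
    using Cons.prems(1) upset_synt[OF x'] x by (simp add: synt_saturated_def)
  moreover have "y' \<in> marked_product L' ps"
    using Cons.IH[OF _ _ y y'] Cons.prems(2) by (simp add: p)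
  ultimately show ?case using v by (simp add: p markI)
qed

text \<open>The finitely many up-sets of level \<open>k\<close> lie in \<open>Pol \<G>\<close> and
  distinguish inequivalent words, so \<open>K\<close> is a Boolean combination of them.\<close>

lemma upset_saturated_in_BPol:
  fixes \<G> :: "('a :: finite) lang set"
  assumes \<G>: "group_prevariety \<G>" and F: "finite F" "F \<subseteq> \<G>"
    and sat: "\<And>u v. upset F k u = upset F k v \<Longrightarrow> u \<in> K \<Longrightarrow> v \<in> K"
  shows "K \<in> BPol \<G>"
proof (rule saturated_in_boolean_algebra[OF BPol_boolean_algebra])
  have G: "\<forall>L\<in>F. group_language L"
    using F group_prevarietyD(3)[OF \<G>] by blast
  show "finite (range (upset F k))"
    using finite_upset[OF F(1) G] .
  show "range (upset F k) \<subseteq> BPol \<G>"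
    using upset_in_Pol[OF F(1) G] Pol_mono[OF synt_saturated_subset[OF \<G> F]] Pol_subset_BPol by blast
  show "v \<in> K" if uv: "\<forall>X\<in>range (upset F k). u \<in> X \<longleftrightarrow> v \<in> X" and "u \<in> K" for u v
  proof (rule sat[OF _ \<open>u \<in> K\<close>])
    show "upset F k u = upset F k v"
      using uv upset_refl[of u F k] upset_refl[of v F k] unfolding upset_eq_iff by blast
  qed
qed

text \<open>The languages saturated at some stage contain \<open>Pol \<G>\<close> and form a Boolean
  algebra, because two stages have a common refinement.\<close>

lemma BPol_upset_saturated:
  assumes "K \<in> BPol \<G>"
  obtains F k where "finite F" "F \<subseteq> \<G>" "\<And>u v. upset F k u = upset F k v \<Longrightarrow> u \<in> K \<Longrightarrow> v \<in> K"
proof -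
  define sat where "sat F k K \<longleftrightarrow> (\<forall>u v. upset F k u = upset F k v \<longrightarrow> u \<in> K \<longrightarrow> v \<in> K)"
    for F k and K :: "'a lang"
  define B where "B = {K. \<exists>F k. finite F \<and> F \<subseteq> \<G> \<and> sat F k K}"
  have mono: "sat F' k' K" if "sat F k K" "F \<subseteq> F'" "k \<le> k'" for F F' k k' K
    using that upset_eq_mono[OF that(2,3)] unfolding sat_def by blast
  have BI: "K \<in> B" if "finite F" "F \<subseteq> \<G>" "sat F k K" for F k K
    using that unfolding B_def by blast
  have two: "\<exists>F k. finite F \<and> F \<subseteq> \<G> \<and> sat F k K \<and> sat F k L" if KL: "K \<in> B" "L \<in> B" for K L
  proof -
    obtain F k where F: "finite F" "F \<subseteq> \<G>" "sat F k K" using KL(1) unfolding B_def by blast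
    obtain F' k' where F': "finite F'" "F' \<subseteq> \<G>" "sat F' k' L" using KL(2) unfolding B_def by blast
    have "sat (F \<union> F') (max k k') K" "sat (F \<union> F') (max k k') L"
      using mono[OF F(3)] mono[OF F'(3)] by auto
    then show ?thesis using F F' by (intro exI[of _ "F \<union> F'"] exI[of _ "max k k'"]) auto
  qed
  have lat: "lang_lattice B"
    unfolding lang_lattice_def
  proof (intro conjI ballI)
    show "{} \<in> B"
      by (rule BI[of "{}" 0]) (simp_all add: sat_def)
    show "UNIV \<in> B"
      by (rule BI[of "{}" 0]) (simp_all add: sat_def)
    fix K L assume "K \<in> B" "L \<in> B"
    from two[OF this] obtain F k where F: "finite F" "F \<subseteq> \<G>" "sat F k K" "sat F k L"
      by blast
    have "sat F k (K \<union> L)" "sat F k (K \<inter> L)"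
      using F(3,4) unfolding sat_def by blast+
    then show "K \<union> L \<in> B" "K \<inter> L \<in> B" using BI[OF F(1,2)] by simp_all
  qed
  have comp: "- K \<in> B" if K: "K \<in> B" for K
  proof -
    obtain F k where F: "finite F" "F \<subseteq> \<G>" "sat F k K" using K unfolding B_def by blast
    have "sat F k (- K)"
      using F(3) unfolding sat_def by (metis ComplD ComplI)
    then show ?thesis using BI[OF F(1,2)] by simp
  qed
  have "Pol \<G> \<subseteq> B"
  proof
    fix K assume "K \<in> Pol \<G>"
    then obtain \<F> where \<F>: "finite \<F>" "\<F> \<subseteq> marked_products \<G>" "K = \<Union> \<F>"
      unfolding Pol_def by blast
    have "M \<in> B" if M: "M \<in> marked_products \<G>" for M
    proof -
      obtain L ps where M: "M = marked_product L ps" "L \<in> \<G>" "snd ` set ps \<subseteq> \<G>"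
        using M unfolding marked_products_def by blast
      \<comment> \<open>The factors themselves generate \<open>F\<close>, which makes each of them
        saturated.\<close>
      define F where "F = insert L (snd ` set ps)"
      have "sat F (length ps) M"
        unfolding sat_def
      proof (intro allI impI)
        fix u v assume eq: "upset F (length ps) u = upset F (length ps) v" and "u \<in> M"
        then show "v \<in> M"
          using marked_product_upset_closed[of L F ps u v] synt_saturated_superset[of F]
          unfolding M upset_eq_iff F_def by blast
      qed
      then show ?thesis using BI[of F] M by (simp add: F_def)
    qed
    then show "K \<in> B"
      using lang_lattice_UN[OF lat \<F>(1), of "\<lambda>X. X"] \<F>(2,3) by auto
  qed
  then have "K \<in> B"
    using assms lat comp unfolding BPol_def lang_boolean_algebra_def by blast
  then show thesis using that unfolding B_def sat_def by blast
qed


section \<open>Sound sets are inseparable\<close>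

lemma run_append: "run \<A> p u q \<Longrightarrow> run \<A> q v r \<Longrightarrow> run \<A> p (u @ v) r"
  by (induction rule: run.induct) (auto intro: run.intros)

lemma run_Cons: "run \<A> p (a # w) r \<longleftrightarrow> (\<exists>q. (p, a, q) \<in> trans \<A> \<and> run \<A> q w r)"
  by (auto elim: run.cases intro: run.intros)

lemma run_Nil: "run \<A> p [] r \<longleftrightarrow> p = r"
  by (auto elim: run.cases intro: run.intros)

lemma run_appendE:
  assumes "run \<A> p (u @ v) r"
  obtains q where "run \<A> p u q" "run \<A> q v r"
proof -
  have "\<exists>q. run \<A> p u q \<and> run \<A> q v r"
    using assms by (induction u arbitrary: p) (simp_all add: run_Cons run_Nil, blast)
  then show thesis using that by blast
qed

lemma run_states:
  assumes "is_nfa \<A>" "run \<A> p w q" "p \<in> states \<A>"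
  shows "q \<in> states \<A>"
  using assms(2,1,3) by (induction rule: run.induct) (auto simp: is_nfa_def)

text \<open>
  A word read by \<open>pump_nfa \<A> S\<close> lies below the words obtained by inserting the chains of the
  quadruples in \<open>S\<close> at the \<open>\<epsilon>\<close>-transitions: so the chains grow by one element.
\<close>

lemma pump_chain:
  assumes S: "\<And>q r s t. (q, r, s, t) \<in> S \<Longrightarrow> \<exists>f. (\<forall>i<h. synt F [] (f i)) \<and>
      (\<forall>i<h. if even i then run \<A> q (f i) r else run \<A> s (f i) t) \<and>
      (\<forall>i. Suc i < h \<longrightarrow> f (Suc i) \<in> upset F k (f i))"
    and run: "eps_run (pump_nfa \<A> S) (p, q, s) w (p', r, t)"
  shows "\<exists>f. run \<A> p w p' \<and> f 0 = w \<and>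
      (\<forall>i<h. if even i then run \<A> q (f (Suc i)) r else run \<A> s (f (Suc i)) t) \<and>
      (\<forall>i<h. f (Suc i) \<in> upset F k (f i))"
  using run
proof (induction "(p, q, s)" w "(p', r, t)" arbitrary: p q s rule: eps_run.induct)
  case eps_run_empty
  show ?case by (rule exI[of _ "\<lambda>_. []"]) (simp add: run_Nil upset_refl)
next
  case (eps_run_letter a p1 w)
  obtain p2 q2 s2 where p1: "p1 = (p2, q2, s2)" by (cases p1)
  then have tr: "(p, a, p2) \<in> trans \<A>" "(q, a, q2) \<in> trans \<A>" "(s, a, s2) \<in> trans \<A>"
    using eps_run_letter(1) by (auto simp: pump_nfa_def)
  obtain f where "run \<A> p2 w p'" "f 0 = w"
    "\<forall>i<h. if even i then run \<A> q2 (f (Suc i)) r else run \<A> s2 (f (Suc i)) t"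
    "\<forall>i<h. f (Suc i) \<in> upset F k (f i)"
    using eps_run_letter(3)[OF p1] by blast
  then show ?case
    using tr by (intro exI[of _ "\<lambda>i. a # f i"]) (auto simp: run_Cons upset_Cons)
next
  case (eps_run_eps p1 w)
  then obtain q2 s2 where p1: "p1 = (p, q2, s2)" and mem: "(q, q2, s, s2) \<in> S"
    by (auto simp: pump_nfa_def)
  obtain f where f: "run \<A> p w p'" "f 0 = w"
    "\<forall>i<h. if even i then run \<A> q2 (f (Suc i)) r else run \<A> s2 (f (Suc i)) t"
    "\<forall>i<h. f (Suc i) \<in> upset F k (f i)"
    using eps_run_eps(3)[OF p1] by blast
  obtain g where g: "\<forall>i<h. synt F [] (g i)"
    "\<forall>i<h. if even i then run \<A> q (g i) q2 else run \<A> s (g i) s2"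
    "\<forall>i. Suc i < h \<longrightarrow> g (Suc i) \<in> upset F k (g i)"
    using S[OF mem] by blast
  \<comment> \<open>The indices are shifted: the first word \<open>w\<close> receives no insertion,
    and the next one receives \<open>g 0\<close>, which is above \<open>[]\<close>. From then on
    both factors grow along their own chains.\<close>
  define e where "e i = (case i of 0 \<Rightarrow> w | Suc j \<Rightarrow> g j @ f (Suc j))" for i
  have "e (Suc i) \<in> upset F k (e i)" if "i < h" for i
  proof (cases i)
    case 0
    then have "g 0 @ f (Suc 0) \<in> upset F k ([] @ f 0)"
      using that f(4) g(1) by (intro upset_append synt_Nil_upset) auto
    then show ?thesis using 0 f(2) by (simp add: e_def)
  next
    case (Suc j)
    then show ?thesis using that f(4) g(3) by (simp add: e_def upset_append)
  qed
  moreover have "if even i then run \<A> q (e (Suc i)) r else run \<A> s (e (Suc i)) t" if "i < h" for i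
    using that f(3) g(2) run_append[of \<A> q "g i" q2 "f (Suc i)" r]
      run_append[of \<A> s "g i" s2 "f (Suc i)" t]
    by (simp add: e_def)
  moreover have "e 0 = w" by (simp add: e_def)
  ultimately show ?case
    using f(1) by (intro exI[of _ e]) simp
qed

text \<open>Each induction step unfolds \<open>S \<subseteq> tau \<G> \<A> S\<close> once and puts a
  new first word in front of a chain with the two languages exchanged.\<close>

lemma alternating_chain:
  assumes \<G>: "group_prevariety \<G>" and F: "finite F" "F \<subseteq> \<G>" and S: "S \<subseteq> tau \<G> \<A> S"
  shows "(q, r, s, t) \<in> S \<Longrightarrow> \<exists>f. (\<forall>i<h. synt F [] (f i)) \<and>
      (\<forall>i<h. if even i then run \<A> q (f i) r else run \<A> s (f i) t) \<and>
      (\<forall>i. Suc i < h \<longrightarrow> f (Suc i) \<in> upset F k (f i))"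
proof (induction h arbitrary: q r s t)
  case 0
  then show ?case by simp
next
  case (Suc h)
  \<comment> \<open>In this condition of \<open>tau\<close> the first track leads from
    \<open>q\<close> to \<open>r\<close> and the second from \<open>s\<close> to \<open>t\<close>,
    which gives the required alternation.\<close>
  have "\<not> separable \<G> {[]} (eps_lang (pump_nfa \<A> S) (q, s, q) (r, t, r))"
    using Suc.prems S unfolding tau_def by blast
  moreover have "{v. synt F [] v} \<in> \<G>"
    using synt_saturated_subset[OF \<G> F] synt_class_saturated by (rule subsetD)
  ultimately obtain w where w: "synt F [] w" "w \<in> eps_lang (pump_nfa \<A> S) (q, s, q) (r, t, r)"
    by (rule not_separable_singletonD) auto
  then have "eps_run (pump_nfa \<A> S) (q, s, q) w (r, t, r)"
    by (simp add: eps_lang_def)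
  from pump_chain[OF Suc.IH this] obtain f where f: "run \<A> q w r" "f 0 = w"
    "\<forall>i<h. if even i then run \<A> s (f (Suc i)) t else run \<A> q (f (Suc i)) r"
    "\<forall>i<h. f (Suc i) \<in> upset F k (f i)"
    by blast
  have "synt F [] (f i)" if "i < Suc h" for i
    using that
  proof (induction i)
    case 0
    then show ?case using w f by simp
  next
    case (Suc i)
    then have "synt F (f i) (f (Suc i))" using f(4) by (intro upset_synt) auto
    then show ?case using Suc by (auto intro: synt_trans)
  qed
  moreover have "if even i then run \<A> q (f i) r else run \<A> s (f i) t" if "i < Suc h" for i
    using that f(1,2,3) by (cases i) auto
  ultimately show ?case using f(4) by (intro exI[of _ f]) auto
qed

text \<open>The finite stages of inseparability: the inseparable quadruples are those in all these
  sets, for finite \<open>F \<subseteq> \<G>\<close> and arbitrary \<open>k\<close>.\<close>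

definition approx_quads ::
    "'a lang set \<Rightarrow> nat \<Rightarrow> ('q, 'a) nfa \<Rightarrow> ('q \<times> 'q \<times> 'q \<times> 'q) set" where
  "approx_quads F k \<A> =
     {(q, r, s, t) \<in> states \<A> \<times> states \<A> \<times> states \<A> \<times> states \<A>. \<exists>u v.
        run \<A> q u r \<and> run \<A> s v t \<and> synt F [] u \<and> synt F [] v \<and> upset F k u = upset F k v}"

lemma approx_quads_mono:
  assumes "F \<subseteq> F'" "k \<le> k'"
  shows "approx_quads F' k' \<A> \<subseteq> approx_quads F k \<A>"
  using upset_eq_mono[OF assms] synt_mono[OF assms(1)] unfolding approx_quads_def by blast

text \<open>A separator in \<open>BPol \<G>\<close> is saturated at some stage. Adding the control
  language \<open>H\<close> to \<open>F\<close> forces the witnesses of that stage into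
  \<open>H\<close>, where the separator cannot tell them apart.\<close>

lemma approx_quads_inseparable:
  assumes approx: "\<And>F k. finite F \<Longrightarrow> F \<subseteq> \<G> \<Longrightarrow> (q, r, s, t) \<in> approx_quads F k \<A>"
  shows "(q, r, s, t) \<in> inseparable_quads (BPol \<G>) \<G> \<A>"
proof -
  have False if sep: "separable_under_control (BPol \<G>) \<G> (nfa_lang \<A> q r) (nfa_lang \<A> s t)"
  proof -
    obtain H K where H: "H \<in> \<G>" "[] \<in> H" and K: "K \<in> BPol \<G>"
      and K1: "nfa_lang \<A> q r \<inter> H \<subseteq> K" and K2: "K \<inter> (nfa_lang \<A> s t \<inter> H) = {}"
      using sep unfolding separable_under_control_def separable_def by blast
    obtain F k where F: "finite F" "F \<subseteq> \<G>"
      and sat: "\<And>u v. upset F k u = upset F k v \<Longrightarrow> u \<in> K \<Longrightarrow> v \<in> K"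
      using BPol_upset_saturated[OF K] by metis
    have "(q, r, s, t) \<in> approx_quads (insert H F) k \<A>"
      using F H by (intro approx) auto
    then obtain u v where uv: "run \<A> q u r" "run \<A> s v t" "synt (insert H F) [] u" "synt (insert H F) [] v"
      and eq: "upset (insert H F) k u = upset (insert H F) k v"
      unfolding approx_quads_def by blast
    have "u \<in> H" "v \<in> H"
      using uv(3,4) H synt_mem[of "insert H F" "[]" _ H] by auto
    moreover have "upset F k u = upset F k v"
      using eq by (rule upset_eq_mono[rotated 2]) auto
    ultimately show False
      using uv(1,2) K1 K2 sat unfolding nfa_lang_def by blast
  qed
  \<comment> \<open>Any stage will do here: it supplies only membership in
    \<open>states \<A>\<close>.\<close>
  moreover have "(q, r, s, t) \<in> approx_quads {} 0 \<A>"
    by (rule approx) auto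
  ultimately show ?thesis unfolding inseparable_quads_def approx_quads_def by blast
qed

text \<open>Take the class of \<open>[]\<close> as control language and let \<open>K\<close> be the
  saturation of the controlled first language. As \<open>K\<close> lies in \<open>BPol \<G>\<close>,
  it must meet the controlled second language, which yields an equivalent pair.\<close>

lemma inseparable_approx_quads:
  fixes \<G> :: "('a :: finite) lang set"
  assumes \<G>: "group_prevariety \<G>" and F: "finite F" "F \<subseteq> \<G>"
  shows "inseparable_quads (BPol \<G>) \<G> \<A> \<subseteq> approx_quads F k \<A>"
proof
  fix x assume x: "x \<in> inseparable_quads (BPol \<G>) \<G> \<A>"
  obtain q r s t where x_eq: "x = (q, r, s, t)" by (cases x)
  let ?H = "{v. synt F [] v}"
  define K where "K = {v. \<exists>u \<in> nfa_lang \<A> q r \<inter> ?H. upset F k u = upset F k v}"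
  have "K \<in> BPol \<G>"
    by (rule upset_saturated_in_BPol[OF \<G> F, of k]) (auto simp: K_def)
  moreover have "nfa_lang \<A> q r \<inter> ?H \<subseteq> K"
    unfolding K_def by blast
  moreover have "?H \<in> \<G>"
    using synt_saturated_subset[OF \<G> F] synt_class_saturated by (rule subsetD)
  moreover have "[] \<in> ?H"
    by simp
  moreover have "\<not> separable_under_control (BPol \<G>) \<G> (nfa_lang \<A> q r) (nfa_lang \<A> s t)"
    using x unfolding x_eq inseparable_quads_def by blast
  ultimately have "K \<inter> (nfa_lang \<A> s t \<inter> ?H) \<noteq> {}"
    by (metis separable_def separable_under_control_def)
  then obtain u v where "run \<A> q u r" "run \<A> s v t" "synt F [] u" "synt F [] v"
    "upset F k u = upset F k v"
    by (auto simp: K_def nfa_lang_def)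
  then show "x \<in> approx_quads F k \<A>"
    using x unfolding x_eq inseparable_quads_def approx_quads_def by blast
qed

lemma subset_tau_imp_inseparable:
  fixes \<G> :: "('a :: finite) lang set"
  assumes \<G>: "group_prevariety \<G>" and S: "S \<subseteq> tau \<G> \<A> S"
  shows "S \<subseteq> inseparable_quads (BPol \<G>) \<G> \<A>"
proof
  fix x assume "x \<in> S"
  moreover obtain q r s t where "x = (q, r, s, t)" by (cases x)
  ultimately have mem: "(q, r, s, t) \<in> S" by simp
  have "(q, r, s, t) \<in> inseparable_quads (BPol \<G>) \<G> \<A>"
  proof (rule approx_quads_inseparable)
    fix F k assume F: "finite F" "F \<subseteq> \<G>"
    have fin: "finite (range (upset F k))"
      using F group_prevarietyD(3)[OF \<G>] by (intro finite_upset) auto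
    define n where "n = card (range (upset F k))"
    obtain f where f: "\<forall>i<Suc n. synt F [] (f i)"
      "\<forall>i<Suc n. if even i then run \<A> q (f i) r else run \<A> s (f i) t"
      "\<forall>i. Suc i < Suc n \<longrightarrow> f (Suc i) \<in> upset F k (f i)"
      using alternating_chain[OF \<G> F S mem] by blast
    have "card ((\<lambda>i. upset F k (f i)) ` {..<Suc n}) \<le> n"
      unfolding n_def by (rule card_mono[OF fin]) auto
    \<comment> \<open>The chain has one element more than there are up-sets.\<close>
    then have "\<not> inj_on (\<lambda>i. upset F k (f i)) {..<Suc n}"
      by (intro pigeonhole) simp
    then obtain i j where ij: "i < j" "j < Suc n" "upset F k (f i) = upset F k (f j)"
      unfolding inj_on_def by (metis lessThan_iff linorder_neqE_nat)
    \<comment> \<open>\<open>f (Suc i)\<close> lies between the equivalent words \<open>f i\<close>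
      and \<open>f j\<close> in the preorder, hence is equivalent to both.\<close>
    have "f j \<in> upset F k (f (Suc i))"
      using Suc_leI[OF ij(1)] ij(2)
    proof (induction j rule: dec_induct)
      case base
      show ?case by (rule upset_refl)
    next
      case (step j)
      then show ?case using f(3) upset_trans by (metis Suc_lessD)
    qed
    then have "f i \<in> upset F k (f (Suc i))"
      using ij(3) upset_refl upset_trans by blast
    then have eq: "upset F k (f i) = upset F k (f (Suc i))"
      using f(3) ij(1,2) unfolding upset_eq_iff by simp
    have "\<exists>u v. run \<A> q u r \<and> run \<A> s v t \<and> synt F [] u \<and> synt F [] v \<and> upset F k u = upset F k v"
    proof (cases "even i")
      case True
      then show ?thesis
        using f(1,2) ij(1,2) eq by (intro exI[of _ "f i"] exI[of _ "f (Suc i)"]) auto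
    next
      case False
      then show ?thesis
        using f(1,2) ij(1,2) eq by (intro exI[of _ "f (Suc i)"] exI[of _ "f i"]) auto
    qed
    moreover have "q \<in> states \<A> \<and> r \<in> states \<A> \<and> s \<in> states \<A> \<and> t \<in> states \<A>"
      using mem S unfolding tau_def by blast
    ultimately show "(q, r, s, t) \<in> approx_quads F k \<A>"
      by (simp add: approx_quads_def)
  qed
  then show "x \<in> inseparable_quads (BPol \<G>) \<G> \<A>"
    using \<open>x = _\<close> by simp
qed


section \<open>Inseparable quadruples form a sound set\<close>

text \<open>The inserted factors stay implicit, so that the relation composes;
  \<open>interleaved\<close> below records them.\<close>

inductive inserted :: "'a lang set \<Rightarrow> 'a list \<Rightarrow> 'a list \<Rightarrow> bool" for F where
  inserted_Nil: "synt F [] x \<Longrightarrow> inserted F [] x"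
| inserted_Cons: "synt F [] x \<Longrightarrow> inserted F w v \<Longrightarrow> inserted F (a # w) (x @ a # v)"

inductive_cases inserted_ConsE: "inserted F (a # w) v"

lemma inserted_refl: "inserted F w w"
  by (induction w) (auto intro: inserted_Nil inserted_Cons[of F "[]", simplified])

lemma synt_insert: "synt F [] x \<Longrightarrow> synt F w v \<Longrightarrow> synt F w (x @ v)"
  using synt_append[of F "[]" x w v] by simp

lemma inserted_synt: "inserted F w v \<Longrightarrow> synt F w v"
  by (induction rule: inserted.induct) (auto intro: synt_insert synt_Cons)

text \<open>In \<open>inserted_trans\<close> the prefix \<open>y\<close> is an inserted factor, and
  its image is again one; hence only the class of that image is kept.\<close>

lemma inserted_split:
  assumes "inserted F (y @ a # w) v"
  shows "\<exists>y' v'. v = y' @ a # v' \<and> synt F y y' \<and> inserted F w v'"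
  using assms
proof (induction y arbitrary: v)
  case Nil
  then have "inserted F (a # w) v" by simp
  then obtain x v' where "v = x @ a # v'" "synt F [] x" "inserted F w v'"
    by (rule inserted_ConsE)
  then show ?case by blast
next
  case (Cons b y)
  then obtain x v1 where v: "v = x @ b # v1" "synt F [] x" "inserted F (y @ a # w) v1"
    by (auto elim: inserted_ConsE)
  obtain y' v' where "v1 = y' @ a # v'" "synt F y y'" "inserted F w v'"
    using Cons.IH[OF v(3)] by blast
  then show ?case
    using v(1,2) by (intro exI[of _ "x @ b # y'"] exI[of _ v']) (simp add: synt_insert synt_Cons)
qed

lemma inserted_trans: "inserted F u w \<Longrightarrow> inserted F w v \<Longrightarrow> inserted F u v"
proof (induction arbitrary: v rule: inserted.induct)
  case (inserted_Nil x)
  then show ?case using inserted_synt synt_trans inserted.inserted_Nil by blast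
next
  case (inserted_Cons x u w a)
  obtain x' v' where v: "v = x' @ a # v'" "synt F x x'" "inserted F w v'"
    using inserted_split[OF inserted_Cons.prems] by blast
  then show ?case
    using inserted_Cons.IH[OF v(3)] synt_trans[OF inserted_Cons.hyps(1) v(2)]
    by (simp add: inserted.inserted_Cons)
qed

lemma inserted_middle: "synt F [] y \<Longrightarrow> inserted F (x @ z) (x @ y @ z)"
proof (induction x)
  case Nil
  show ?case
  proof (cases z)
    case Nil
    then show ?thesis using \<open>synt F [] y\<close> by (simp add: inserted_Nil)
  next
    case (Cons b z')
    then show ?thesis using \<open>synt F [] y\<close> by (simp add: inserted_Cons inserted_refl)
  qed
next
  case (Cons b x)
  then show ?case using inserted_Cons[of F "[]" "x @ z" "x @ y @ z" b] by simp
qed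

text \<open>
  Cutting a loop of \<open>\<A>\<close> on which the class of the prefix does not change removes, by
  cancellation in the group, a factor equivalent to \<open>\<epsilon>\<close>.
\<close>

lemma short_inserted:
  assumes nfa: "is_nfa \<A>" and F: "finite F" "\<forall>L\<in>F. group_language L"
    and run: "run \<A> s v t" and s: "s \<in> states \<A>"
  obtains w where "inserted F w v" "run \<A> s w t"
    "length w < card (states \<A> \<times> range (\<lambda>u. {v. synt F u v}))"
proof -
  let ?C = "states \<A> \<times> range (\<lambda>u. {v. synt F u v})"
  \<comment> \<open>Minimal length leaves no loop that could still be cut out.\<close>
  obtain w where w: "inserted F w v" "run \<A> s w t"
    and least: "\<And>w'. inserted F w' v \<Longrightarrow> run \<A> s w' t \<Longrightarrow> length w \<le> length w'"
    using ex_has_least_nat[of "\<lambda>w. inserted F w v \<and> run \<A> s w t" v length] inserted_refl run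
    by blast
  have "length w < card ?C"
  proof (rule ccontr)
    assume long: "\<not> length w < card ?C"
    have "\<exists>p. run \<A> s (take i w) p \<and> run \<A> p (drop i w) t" for i
      using w(2) run_appendE[of \<A> s "take i w" "drop i w" t] by (metis append_take_drop_id)
    then obtain p where p: "\<And>i. run \<A> s (take i w) (p i)" "\<And>i. run \<A> (p i) (drop i w) t"
      by metis
    have fin: "finite ?C"
      using nfa finite_synt_classes[OF F] by (simp add: is_nfa_def)
    have "(\<lambda>i. (p i, {v. synt F (take i w) v})) ` {..length w} \<subseteq> ?C"
      using run_states[OF nfa p(1) s] by auto
    then have "card ((\<lambda>i. (p i, {v. synt F (take i w) v})) ` {..length w}) \<le> card ?C"
      by (rule card_mono[OF fin])
    \<comment> \<open>\<open>w\<close> has \<open>length w + 1\<close> prefixes, the empty one and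
      \<open>w\<close> included.\<close>
    then have "\<not> inj_on (\<lambda>i. (p i, {v. synt F (take i w) v})) {..length w}"
      using long by (intro pigeonhole) simp
    then obtain i j where ij: "i < j" "j \<le> length w" "p i = p j"
      "{v. synt F (take i w) v} = {v. synt F (take j w) v}"
      unfolding inj_on_def by (metis (no_types, lifting) Pair_inject atMost_iff linorder_neqE_nat)
    define y where "y = take (j - i) (drop i w)"
    have j: "take j w = take i w @ y"
      using take_add[of i "j - i" w] ij(1) by (simp add: y_def)
    then have w_eq: "w = take i w @ y @ drop j w"
      by (metis append_assoc append_take_drop_id)
    have "synt F (take i w) (take j w)"
      using ij(4) synt_refl by blast
    then have "synt F [] y"
      using synt_cancel[OF F(2)] j by simp
    then have "inserted F (take i w @ drop j w) w"
      using inserted_middle w_eq by metis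
    then have "inserted F (take i w @ drop j w) v"
      using w(1) inserted_trans by blast
    moreover have "run \<A> s (take i w @ drop j w) t"
      using run_append[OF p(1)[of i], of "drop j w" t] p(2)[of j] ij(3) by simp
    ultimately have "length w \<le> length (take i w @ drop j w)"
      by (rule least)
    then show False using ij by simp
  qed
  then show thesis using that w by blast
qed

text \<open>\<open>interleaved [a\<^sub>1, \<dots>, a\<^sub>n] [x\<^sub>0, \<dots>, x\<^sub>n] v\<close> means \<open>v = x\<^sub>0 a\<^sub>1 x\<^sub>1 \<cdots> a\<^sub>n x\<^sub>n\<close>.\<close>

inductive interleaved :: "'a list \<Rightarrow> 'a list list \<Rightarrow> 'a list \<Rightarrow> bool" where
  interleaved_Nil: "interleaved [] [x] x"
| interleaved_Cons: "interleaved w xs v \<Longrightarrow> interleaved (a # w) (x # xs) (x @ a # v)"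

lemma inserted_interleaved:
  "inserted F w v \<Longrightarrow> \<exists>xs. interleaved w xs v \<and> (\<forall>x\<in>set xs. synt F [] x)"
proof (induction rule: inserted.induct)
  case (inserted_Nil x)
  then show ?case by (intro exI[of _ "[x]"]) (simp add: interleaved_Nil)
next
  case (inserted_Cons x w v a)
  then obtain xs where "interleaved w xs v" "\<forall>x\<in>set xs. synt F [] x" by blast
  then show ?case
    using inserted_Cons by (intro exI[of _ "x # xs"]) (simp add: interleaved_Cons)
qed

text \<open>Answering the letters of \<open>w\<close> one by one uses up \<open>length w\<close>
  levels and leaves level \<open>k\<close> for each factor.\<close>

lemma interleaved_upset:
  assumes "interleaved w xs u" "u' \<in> upset F (k + length w) u"
  shows "\<exists>ys. interleaved w ys u' \<and> list_all2 (\<lambda>x y. y \<in> upset F k x) xs ys"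
  using assms
proof (induction arbitrary: u' rule: interleaved.induct)
  case (interleaved_Nil x)
  then show ?case by (intro exI[of _ "[u']"]) (simp add: interleaved.interleaved_Nil)
next
  case (interleaved_Cons w xs v a x)
  then have "u' \<in> upset F (Suc (k + length w)) (x @ a # v)" by simp
  then obtain x' v' where u': "u' = x' @ a # v'" "x' \<in> upset F (k + length w) x"
    "v' \<in> upset F (k + length w) v"
    by (rule upset_SucE)
  obtain ys where "interleaved w ys v'" "list_all2 (\<lambda>x y. y \<in> upset F k x) xs ys"
    using interleaved_Cons.IH[OF u'(3)] by blast
  moreover have "x' \<in> upset F k x"
    using u'(2) upset_antimono[of k "k + length w"] by auto
  ultimately show ?case
    using u'(1) by (intro exI[of _ "x' # ys"]) (simp add: interleaved.interleaved_Cons)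
qed

text \<open>With finitely many up-sets, this number drops whenever a word is replaced by one
  strictly above it; ascending chains can thus be controlled by minimization.\<close>

definition upset_rank :: "'a lang set \<Rightarrow> nat \<Rightarrow> 'a list \<Rightarrow> nat" where
  "upset_rank F k x = card {X \<in> range (upset F k). X \<subseteq> upset F k x}"

lemma upset_rank_mono:
  assumes fin: "finite (range (upset F k))" and y: "y \<in> upset F k x"
  shows "upset_rank F k y \<le> upset_rank F k x"
    and "upset_rank F k y = upset_rank F k x \<Longrightarrow> upset F k y = upset F k x"
proof -
  have sub: "upset F k y \<subseteq> upset F k x"
    using y upset_trans by blast
  then have sub': "{X \<in> range (upset F k). X \<subseteq> upset F k y} \<subseteq> {X \<in> range (upset F k). X \<subseteq> upset F k x}"
    by blast
  have fin': "finite {X \<in> range (upset F k). X \<subseteq> upset F k x}"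
    using fin by simp
  show "upset_rank F k y \<le> upset_rank F k x"
    unfolding upset_rank_def by (rule card_mono[OF fin' sub'])
  assume "upset_rank F k y = upset_rank F k x"
  then have "{X \<in> range (upset F k). X \<subseteq> upset F k y} = {X \<in> range (upset F k). X \<subseteq> upset F k x}"
    unfolding upset_rank_def by (rule card_subset_eq[OF fin' sub'])
  moreover have "upset F k x \<in> {X \<in> range (upset F k). X \<subseteq> upset F k x}"
    by simp
  ultimately have "upset F k x \<in> {X \<in> range (upset F k). X \<subseteq> upset F k y}"
    by (rule equalityD2[THEN subsetD])
  then have "upset F k x \<subseteq> upset F k y"
    by simp
  with sub show "upset F k y = upset F k x"
    by (rule subset_antisym)
qed

text \<open>No rank increases in any position, so equal sums force equal ranks everywhere.\<close>

lemma upset_rank_list_mono: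
  assumes fin: "finite (range (upset F k))" and "list_all2 (\<lambda>x y. y \<in> upset F k x) xs ys"
  shows "sum_list (map (upset_rank F k) ys) \<le> sum_list (map (upset_rank F k) xs) \<and>
    (sum_list (map (upset_rank F k) ys) = sum_list (map (upset_rank F k) xs) \<longrightarrow>
      map (upset F k) ys = map (upset F k) xs)"
  using assms(2)
proof (induction rule: list_all2_induct)
  case Nil
  then show ?case by simp
next
  case (Cons x xs y ys)
  then show ?case using upset_rank_mono[OF fin Cons(1)] by auto
qed

text \<open>
  Passing back and forth between \<open>u\<close> and \<open>v\<close>, the factors can only go up in the preorder; a
  factorization of minimal rank is thus matched by an equivalent one.
\<close>

lemma equivalent_interleavings:
  assumes fin: "finite (range (upset F k))"
    and eq: "upset F (k + length w) u = upset F (k + length w) v" and ins: "inserted F w v"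
  obtains xs ys where "interleaved w xs u" "interleaved w ys v"
    "map (upset F k) xs = map (upset F k) ys"
    "\<forall>x\<in>set xs. synt F [] x" "\<forall>y\<in>set ys. synt F [] y"
proof -
  let ?P = "\<lambda>ys. interleaved w ys v \<and> (\<forall>y\<in>set ys. synt F [] y)"
  let ?m = "\<lambda>xs. sum_list (map (upset_rank F k) xs)"
  let ?le = "list_all2 (\<lambda>x y. y \<in> upset F k x)"
  have uv: "u \<in> upset F (k + length w) v" "v \<in> upset F (k + length w) u"
    using eq unfolding upset_eq_iff by auto
  have synt: "\<forall>y\<in>set ys. synt F [] y" if "?le xs ys" "\<forall>x\<in>set xs. synt F [] x" for xs ys
    using that by (induction rule: list_all2_induct) (auto dest: upset_synt intro: synt_trans)
  obtain ys where ys: "?P ys" and least: "\<And>zs. ?P zs \<Longrightarrow> ?m ys \<le> ?m zs"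
    using inserted_interleaved[OF ins] ex_has_least_nat[of ?P _ ?m] by metis
  obtain xs where xs: "interleaved w xs u" "?le ys xs"
    using ys interleaved_upset[OF _ uv(1)] by blast
  obtain zs where zs: "interleaved w zs v" "?le xs zs"
    using interleaved_upset[OF xs(1) uv(2)] by blast
  have synt_xs: "\<forall>x\<in>set xs. synt F [] x"
    using synt[OF xs(2)] ys by blast
  \<comment> \<open>The ranks also satisfy \<open>?m zs \<le> ?m xs \<le> ?m ys\<close>, so all
    three agree.\<close>
  then have "?m ys \<le> ?m zs"
    using least zs synt[OF zs(2)] by blast
  then have "map (upset F k) xs = map (upset F k) ys"
    using upset_rank_list_mono[OF fin xs(2)] upset_rank_list_mono[OF fin zs(2)] by simp
  then show thesis
    using that xs(1) ys synt_xs by blast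
qed

text \<open>The three tracks move together on the letters of \<open>w\<close>. Each pair of
  corresponding factors of \<open>u\<close> and \<open>v\<close> is replaced by one
  \<epsilon>-transition, during which the first track stands still.\<close>

lemma interleaved_eps_run:
  assumes nfa: "is_nfa \<A>"
    and "interleaved w xs u" "interleaved w ys v"
    and "list_all2 (\<lambda>x y. \<forall>q\<in>states \<A>. \<forall>s\<in>states \<A>. \<forall>r t.
      run \<A> q x r \<longrightarrow> run \<A> s y t \<longrightarrow> (q, r, s, t) \<in> S) xs ys"
    and "p \<in> states \<A>" "q \<in> states \<A>" "s \<in> states \<A>"
    and "run \<A> p w p'" "run \<A> q u r" "run \<A> s v t"
  shows "eps_run (pump_nfa \<A> S) (p, q, s) w (p', r, t)"
  using assms(2-)
proof (induction arbitrary: ys v p q s rule: interleaved.induct)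
  case (interleaved_Nil x)
  then have "ys = [v]" by (auto elim: interleaved.cases)
  then have "((p, q, s), None, (p, r, t)) \<in> trans (pump_nfa \<A> S)"
    using interleaved_Nil by (simp add: pump_nfa_def)
  then show ?case
    using interleaved_Nil by (auto simp: run_Nil intro: eps_run.intros)
next
  case (interleaved_Cons w xs u a x)
  obtain y ys' v' where v: "ys = y # ys'" "v = y @ a # v'" "interleaved w ys' v'"
    using interleaved_Cons.prems(1) by (auto elim: interleaved.cases)
  obtain p1 where p1: "(p, a, p1) \<in> trans \<A>" "run \<A> p1 w p'"
    using interleaved_Cons.prems by (auto simp: run_Cons)
  obtain q1 q2 where q: "run \<A> q x q1" "(q1, a, q2) \<in> trans \<A>" "run \<A> q2 u r"
    using interleaved_Cons.prems(7) by (metis run_appendE run_Cons)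
  obtain s1 s2 where s: "run \<A> s y s1" "(s1, a, s2) \<in> trans \<A>" "run \<A> s2 v' t"
    using interleaved_Cons.prems(8) unfolding v(2) by (metis run_appendE run_Cons)
  have "((p, q, s), None, (p, q1, s1)) \<in> trans (pump_nfa \<A> S)"
    using interleaved_Cons.prems q(1) s(1) v(1) by (simp add: pump_nfa_def)
  moreover have "((p, q1, s1), Some a, (p1, q2, s2)) \<in> trans (pump_nfa \<A> S)"
    using p1 q s by (simp add: pump_nfa_def)
  moreover have "p1 \<in> states \<A>" "q2 \<in> states \<A>" "s2 \<in> states \<A>"
    using nfa p1(1) q(2) s(2) by (auto simp: is_nfa_def)
  then have "eps_run (pump_nfa \<A> S) (p1, q2, s2) w (p', r, t)"
    using interleaved_Cons.prems(2) v(1) p1(2) q(3) s(3)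
    by (intro interleaved_Cons.IH[OF v(3)]) auto
  ultimately show ?case
    by (blast intro: eps_run.intros)
qed

text \<open>There are finitely many quadruples, and each separable one drops out at some stage. The
  stages decrease, so a common refinement excludes all of these at once. \<open>F0\<close> allows
  further languages to be forced into \<open>F\<close>.\<close>

lemma approx_quads_limit:
  fixes \<G> :: "('a :: finite) lang set"
  assumes nfa: "is_nfa \<A>" and F0: "finite F0" "F0 \<subseteq> \<G>"
  obtains F k where "finite F" "F0 \<subseteq> F" "F \<subseteq> \<G>"
    "approx_quads F k \<A> \<subseteq> inseparable_quads (BPol \<G>) \<G> \<A>"
proof -
  let ?I = "inseparable_quads (BPol \<G>) \<G> \<A>"
  define T where "T = states \<A> \<times> states \<A> \<times> states \<A> \<times> states \<A> - ?I"
  have fin: "finite T"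
    using nfa by (simp add: T_def is_nfa_def)
  have "\<exists>F k. finite F \<and> F \<subseteq> \<G> \<and> x \<notin> approx_quads F k \<A>" if "x \<in> T" for x
  proof -
    obtain q r s t where "x = (q, r, s, t)" by (cases x)
    then show ?thesis
      using that approx_quads_inseparable[of \<G> q r s t \<A>] unfolding T_def by blast
  qed
  then obtain f g where fg: "\<And>x. x \<in> T \<Longrightarrow> finite (f x) \<and> f x \<subseteq> \<G> \<and> x \<notin> approx_quads (f x) (g x) \<A>"
    by metis
  define F where "F = F0 \<union> (\<Union>x\<in>T. f x)"
  define k where "k = sum g T"
  have "x \<notin> approx_quads F k \<A>" if x: "x \<in> T" for x
  proof -
    have "f x \<subseteq> F" using x by (auto simp: F_def)
    moreover have "g x \<le> k" unfolding k_def using fin x by (intro member_le_sum) auto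
    ultimately show ?thesis using approx_quads_mono fg[OF x] by blast
  qed
  moreover have "approx_quads F k \<A> \<subseteq> states \<A> \<times> states \<A> \<times> states \<A> \<times> states \<A>"
    unfolding approx_quads_def by blast
  ultimately have "approx_quads F k \<A> \<subseteq> ?I"
    unfolding T_def by blast
  moreover have "finite F" "F0 \<subseteq> F"
    using fin F0 fg by (auto simp: F_def)
  moreover have "F \<subseteq> \<G>"
    using F0 fg unfolding F_def by blast
  ultimately show thesis using that by blast
qed

text \<open>This gives the first condition of \<open>tau\<close>; exchanging the two languages by
  \<open>inseparable_quads_sym\<close> gives the second.\<close>

lemma inseparable_not_separable_pump:
  fixes \<G> :: "('a :: finite) lang set"
  assumes \<G>: "group_prevariety \<G>" and nfa: "is_nfa \<A>"
    and mem: "(q, r, s, t) \<in> inseparable_quads (BPol \<G>) \<G> \<A>" (is "_ \<in> ?I")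
  shows "\<not> separable \<G> {[]} (eps_lang (pump_nfa \<A> ?I) (s, q, s) (t, r, t))"
proof
  assume "separable \<G> {[]} (eps_lang (pump_nfa \<A> ?I) (s, q, s) (t, r, t))"
  then obtain H where H: "H \<in> \<G>" "[] \<in> H" "H \<inter> eps_lang (pump_nfa \<A> ?I) (s, q, s) (t, r, t) = {}"
    unfolding separable_def by blast
  \<comment> \<open>With \<open>H \<in> F\<close>, every word equivalent to \<open>[]\<close> lies
    in \<open>H\<close>, in particular the word \<open>w\<close> found below.\<close>
  obtain F k where F: "finite F" "{H} \<subseteq> F" "F \<subseteq> \<G>" and lim: "approx_quads F k \<A> \<subseteq> ?I"
    using approx_quads_limit[OF nfa, of "{H}" \<G>] H(1) by auto
  have grp: "\<forall>L\<in>F. group_language L"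
    using F(3) group_prevarietyD(3)[OF \<G>] by blast
  \<comment> \<open>\<open>n\<close> depends on \<open>F\<close> but not on the witnesses, so the
    levels spent on the letters of \<open>w\<close> can be reserved before \<open>u\<close> and
    \<open>v\<close> are chosen.\<close>
  define n where "n = card (states \<A> \<times> range (\<lambda>u. {v. synt F u v}))"
  have "(q, r, s, t) \<in> approx_quads F (k + n) \<A>"
    using inseparable_approx_quads[OF \<G> F(1,3)] mem by blast
  then obtain u v where st: "q \<in> states \<A>" "s \<in> states \<A>"
    and u: "run \<A> q u r" and v: "run \<A> s v t" "synt F [] v"
    and eq: "upset F (k + n) u = upset F (k + n) v"
    unfolding approx_quads_def by blast
  obtain w where w: "inserted F w v" "run \<A> s w t" "length w < n"
    using short_inserted[OF nfa F(1) grp v(1) st(2)] unfolding n_def by blast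
  have "upset F (k + length w) u = upset F (k + length w) v"
    using upset_eq_mono[OF subset_refl _ eq] w(3) by simp
  then obtain xs ys where xy: "interleaved w xs u" "interleaved w ys v"
    "map (upset F k) xs = map (upset F k) ys"
    "\<forall>x\<in>set xs. synt F [] x" "\<forall>y\<in>set ys. synt F [] y"
    using equivalent_interleavings[OF finite_upset[OF F(1) grp] _ w(1)] by blast
  \<comment> \<open>Corresponding factors are equivalent at level \<open>k\<close> and lie in the
    class of \<open>[]\<close>, so they witness membership in \<open>approx_quads F k \<A>\<close>,
    which is contained in \<open>?I\<close>.\<close>
  have "list_all2 (\<lambda>x y. \<forall>q\<in>states \<A>. \<forall>s\<in>states \<A>. \<forall>r t.
      run \<A> q x r \<longrightarrow> run \<A> s y t \<longrightarrow> (q, r, s, t) \<in> ?I) xs ys"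
    unfolding list_all2_conv_all_nth
  proof (intro conjI allI impI ballI)
    show len: "length xs = length ys"
      using xy(3) by (rule map_eq_imp_length_eq)
    fix i q s r t
    assume *: "i < length xs" "q \<in> states \<A>" "s \<in> states \<A>" "run \<A> q (xs ! i) r" "run \<A> s (ys ! i) t"
    have "upset F k (xs ! i) = upset F k (ys ! i)"
      using xy(3) *(1) len by (metis nth_map)
    moreover have "synt F [] (xs ! i)" "synt F [] (ys ! i)"
      using xy(4,5) *(1) len by simp_all
    moreover have "r \<in> states \<A>" "t \<in> states \<A>"
      using run_states[OF nfa] * by blast+
    ultimately have "(q, r, s, t) \<in> approx_quads F k \<A>"
      using * unfolding approx_quads_def by blast
    then show "(q, r, s, t) \<in> ?I" using lim by blast
  qed
  then have "eps_run (pump_nfa \<A> ?I) (s, q, s) w (t, r, t)"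
    using interleaved_eps_run[OF nfa xy(1,2)] st w(2) u v(1) by blast
  moreover have "w \<in> H"
  proof -
    have "synt F [] w"
      using v(2) inserted_synt[OF w(1)] by (blast intro: synt_trans synt_sym)
    then show ?thesis using synt_mem[of F "[]" w H] F(2) H(2) by simp
  qed
  ultimately show False using H(3) by (auto simp: eps_lang_def)
qed

lemma inseparable_quads_sym:
  assumes "lang_boolean_algebra C" "(q, r, s, t) \<in> inseparable_quads C D \<A>"
  shows "(s, t, q, r) \<in> inseparable_quads C D \<A>"
  using assms(2) separable_commute[OF assms(1)]
  unfolding inseparable_quads_def separable_under_control_def by blast

lemma inseparable_subset_tau:
  fixes \<G> :: "('a :: finite) lang set"
  assumes \<G>: "group_prevariety \<G>" and nfa: "is_nfa \<A>"
  shows "inseparable_quads (BPol \<G>) \<G> \<A> \<subseteq> tau \<G> \<A> (inseparable_quads (BPol \<G>) \<G> \<A>)"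
proof
  fix x assume x: "x \<in> inseparable_quads (BPol \<G>) \<G> \<A>"
  obtain q r s t where x_eq: "x = (q, r, s, t)" by (cases x)
  note mem = x[unfolded x_eq]
  have "q \<in> states \<A> \<and> r \<in> states \<A> \<and> s \<in> states \<A> \<and> t \<in> states \<A>"
    using mem unfolding inseparable_quads_def by blast
  then show "x \<in> tau \<G> \<A> (inseparable_quads (BPol \<G>) \<G> \<A>)"
    using inseparable_not_separable_pump[OF \<G> nfa mem]
      inseparable_not_separable_pump[OF \<G> nfa inseparable_quads_sym[OF BPol_boolean_algebra mem]]
    unfolding x_eq tau_def by blast
qed

section \<open>Monotonicity of \<open>tau\<close> and the greatest fixpoint\<close>

lemma eps_run_pump_mono:
  assumes "eps_run (pump_nfa \<A> S) p w q" "S \<subseteq> S'"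
  shows "eps_run (pump_nfa \<A> S') p w q"
proof -
  have "trans (pump_nfa \<A> S) \<subseteq> trans (pump_nfa \<A> S')"
    using assms(2) unfolding pump_nfa_def by auto
  then show ?thesis
    using assms(1) by (induction rule: eps_run.induct[OF assms(1)]) (auto intro: eps_run.intros)
qed

lemma tau_mono:
  assumes "S \<subseteq> S'"
  shows "tau \<G> \<A> S \<subseteq> tau \<G> \<A> S'"
proof -
  have "eps_lang (pump_nfa \<A> S) p q \<subseteq> eps_lang (pump_nfa \<A> S') p q" for p q
    unfolding eps_lang_def by (blast intro: eps_run_pump_mono[OF _ assms])
  then have "separable \<G> {[]} (eps_lang (pump_nfa \<A> S) p q)"
    if "separable \<G> {[]} (eps_lang (pump_nfa \<A> S') p q)" for p q
    using separable_antimono[OF that] by blast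
  then show ?thesis unfolding tau_def by auto
qed

theorem theorem20:
  fixes \<G> :: "('a :: finite) lang set" and \<A> :: "('q, 'a) nfa"
  assumes "group_prevariety \<G>" and "is_nfa \<A>"
  shows "bpol_sound \<G> \<A> (inseparable_quads (BPol \<G>) \<G> \<A>) \<and>
    (\<forall>S. bpol_sound \<G> \<A> S \<longrightarrow> S \<subseteq> inseparable_quads (BPol \<G>) \<G> \<A>)"
proof -
  let ?I = "inseparable_quads (BPol \<G>) \<G> \<A>"
  have sub: "?I \<subseteq> tau \<G> \<A> ?I"
    using assms by (rule inseparable_subset_tau)
  \<comment> \<open>As in the Knaster-Tarski argument, monotonicity turns
    \<open>tau \<G> \<A> ?I\<close> into another set contained in its own image, and
    \<open>?I\<close> contains all such sets.\<close>
  have "tau \<G> \<A> ?I \<subseteq> ?I"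
    using assms(1) tau_mono[OF sub] by (rule subset_tau_imp_inseparable)
  with sub have "tau \<G> \<A> ?I = ?I" by (rule subset_antisym[rotated])
  moreover have "?I \<subseteq> states \<A> \<times> states \<A> \<times> states \<A> \<times> states \<A>"
    unfolding inseparable_quads_def by blast
  moreover have "S \<subseteq> ?I" if "bpol_sound \<G> \<A> S" for S
    using that subset_tau_imp_inseparable[OF assms(1)] unfolding bpol_sound_def by blast
  ultimately show ?thesis unfolding bpol_sound_def by blast
qed

end
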